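(* Let $(c_1,c_2)\in(0,\infty)^2$. For an integer $T\ge 4$ let $\mathcal S_T$ be the (non-empty) set of square free semiprimes whose prime divisors are less than $T$, and consider its subsets $$\mathcal S^1_{T,c_1,c_2}:=\{N\in\mathcal S_T\mid \exists (m,a)\in\mathbb N\times\mathbb Z:\ N\text{ has property }(\sharp_{m;a}),\ m<T^{c_1},\ |a|<T^{c_2}\},$$ $$\mathcal S^2_{T,c_1,c_2}:=\{N\in\mathcal S_T\mid \exists (m,a)\in\mathbb N\times\mathbb Z:\ N\text{ has property }(\natural_{m;a}),\ m<T^{c_1},\ |a|<T^{c_2}\}.$$ Then the following properties hold. (1) If $3c_1+c_2<1$, then both limits $\lim_{T\to\infty}\frac{|\mathcal S^1_{T,c_1,c_2}|}{|\mathcal S_T|}$ and $\lim_{T\to\infty}\frac{|\mathcal S^2_{T,c_1,c_2}|}{|\mathcal S_T|}$ exist and are $0$. (2) There exists no constant $C\in(0,\infty)$ such that each sufficiently large square free semiprime $N$ has property $(\sharp_{m;a})$ or $(\natural_{m;a})$ for a pair $(m,a)\in\mathbb N\times\mathbb Z$ with $\max(m,|a|)<(\log N)^C$.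
   Context: $\mathbb N$ is the set of positive integers. A square free semiprime is a product of two distinct primes. Property $(\sharp_{m;a})$: for $(N,m,a)\in\mathbb N^2\times\mathbb Z$, $N$ has property $(\sharp_{m;a})$ if there exists no monic polynomial in $(\mathbb Z/N\mathbb Z)[X]$ which generates the ideal of $(\mathbb Z/N\mathbb Z)[X]$ generated by the reductions modulo $N$ of $X^m-1$ and $(a-X)^m-1$. Property $(\natural_{m;a})$: let $m\in\mathbb N\setminus\{1,2\}$, $a\in\mathbb Z$ and let $N$ be a natural number with at least two distinct prime divisors. $N$ has property $(\natural_{m;a})$ if there exist distinct prime divisors $p,q$ of $N$ such that $p\nmid m$ and the equation $X^p+Y^p=a$ has a solution $(X_1,Y_1)$ formed by $m$-th roots of unity in an algebraic closure $\overline{\mathbb F_q}$ of $\mathbb F_q$ with $X_1+Y_1\ne a$. (For $m\in\{1,2\}$ no $N$ has property $(\natural_{m;a})$.) *)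

theory Defs
  imports
    Complex_Main
    "HOL-Algebra.Algebraic_Closure"
    "HOL-Algebra.UnivPoly"
    "HOL-Computational_Algebra.Polynomial"
    "HOL-Number_Theory.Number_Theory"
begin

definition squarefree_semiprime :: "nat \<Rightarrow> bool" where
  "squarefree_semiprime N \<longleftrightarrow>
     (\<exists>p q. Factorial_Ring.prime p \<and> Factorial_Ring.prime q \<and> p \<noteq> q \<and> N = p * q)"

text \<open>Reduction modulo \<open>N\<close> of an integer polynomial, as an element of the univariate
  polynomial ring \<open>UP (residue_ring N)\<close>, whose elements are coefficient functions.\<close>

definition reduce_poly :: "nat \<Rightarrow> int poly \<Rightarrow> (nat \<Rightarrow> int)" where
  "reduce_poly N P = (\<lambda>i. Polynomial.coeff P i mod int N)"

definition monic_UP :: "('a, 'b) ring_scheme \<Rightarrow> (nat \<Rightarrow> 'a) \<Rightarrow> bool" where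
  "monic_UP R f \<longleftrightarrow> f \<in> carrier (UP R) \<and> up_ring.coeff (UP R) f (UnivPoly.deg R f) = \<one>\<^bsub>R\<^esub>"

text \<open>The guard \<open>1 < N\<close> is needed because \<open>residue_ring 1\<close> is not the zero ring (its unit
  is \<open>1\<close>, outside its carrier). It agrees with the mathematics: over the zero ring the only
  polynomial \<open>0 = 1\<close> is monic and generates every ideal, so \<open>N = 1\<close> never has the property.\<close>

definition sharp_property :: "nat \<Rightarrow> nat \<Rightarrow> int \<Rightarrow> bool" where
  "sharp_property N m a \<longleftrightarrow> 1 < N \<and>
     (let R = residue_ring (int N) in
      \<not> (\<exists>f. monic_UP R f \<and>
             Idl\<^bsub>UP R\<^esub> {f} =
             Idl\<^bsub>UP R\<^esub> {reduce_poly N (Polynomial.monom 1 m - 1),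
                         reduce_poly N ([:a, -1:] ^ m - 1)}))"

text \<open>Here \<open>L\<close> is an algebraic closure of the field with \<open>q\<close> elements, and the integer \<open>a\<close> is
  viewed in \<open>L\<close> as \<open>[a] \<cdot>\<^bsub>L\<^esub> \<one>\<^bsub>L\<^esub>\<close>.\<close>

definition natural_property :: "nat \<Rightarrow> nat \<Rightarrow> int \<Rightarrow> bool" where
  "natural_property N m a \<longleftrightarrow> N > 0 \<and> m \<ge> 3 \<and>
     (\<exists>p q. Factorial_Ring.prime p \<and> Factorial_Ring.prime q \<and> p \<noteq> q \<and>
       p dvd N \<and> q dvd N \<and> \<not> p dvd m \<and>
       (let L = field.alg_closure (residue_ring (int q)) in
        \<exists>x\<in>carrier L. \<exists>y\<in>carrier L.
          x [^]\<^bsub>L\<^esub> m = \<one>\<^bsub>L\<^esub> \<and> y [^]\<^bsub>L\<^esub> m = \<one>\<^bsub>L\<^esub> \<and>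
          x [^]\<^bsub>L\<^esub> p \<oplus>\<^bsub>L\<^esub> y [^]\<^bsub>L\<^esub> p = [a] \<cdot>\<^bsub>L\<^esub> \<one>\<^bsub>L\<^esub> \<and>
          x \<oplus>\<^bsub>L\<^esub> y \<noteq> [a] \<cdot>\<^bsub>L\<^esub> \<one>\<^bsub>L\<^esub>))"

definition semiprimes_below :: "nat \<Rightarrow> nat set" where
  "semiprimes_below T = {N. squarefree_semiprime N \<and>
     (\<forall>p. Factorial_Ring.prime p \<longrightarrow> p dvd N \<longrightarrow> p < T)}"

definition sharp_set :: "nat \<Rightarrow> real \<Rightarrow> real \<Rightarrow> nat set" where
  "sharp_set T c1 c2 = {N \<in> semiprimes_below T. \<exists>(m::nat) (a::int). m > 0 \<and>
     sharp_property N m a \<and> real m < real T powr c1 \<and> real_of_int \<bar>a\<bar> < real T powr c2}"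

definition natural_set :: "nat \<Rightarrow> real \<Rightarrow> real \<Rightarrow> nat set" where
  "natural_set T c1 c2 = {N \<in> semiprimes_below T. \<exists>(m::nat) (a::int). m > 0 \<and>
     natural_property N m a \<and> real m < real T powr c1 \<and> real_of_int \<bar>a\<bar> < real T powr c2}"

text \<open>The cardinalities used as numerator and denominator of the densities are therefore genuine
  ones, and for \<open>T \<ge> 4\<close> the quotients do not involve division by zero.\<close>

lemma finite_semiprimes_below: "finite (semiprimes_below T)"
proof (rule finite_subset)
  show "semiprimes_below T \<subseteq> {..T * T}"
  proof
    fix N assume "N \<in> semiprimes_below T"
    then obtain p q where "N = p * q" "p < T" "q < T"
      by (auto simp: semiprimes_below_def squarefree_semiprime_def)
    then show "N \<in> {..T * T}" by (simp add: mult_le_mono)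
  qed
qed simp

lemma semiprimes_below_nonempty:
  assumes "T \<ge> 4"
  shows "semiprimes_below T \<noteq> {}"
proof -
  have p3: "Factorial_Ring.prime (3::nat)" by simp
  have "squarefree_semiprime (2 * 3)"
    unfolding squarefree_semiprime_def using p3 two_is_prime_nat by fastforce
  moreover have "p < T" if "Factorial_Ring.prime p" "p dvd 2 * 3" for p :: nat
  proof -
    have "p dvd 2 \<or> p dvd 3" using that prime_dvd_mult_iff by blast
    then have "p \<le> 3" by (auto dest: dvd_imp_le)
    with assms show ?thesis by simp
  qed
  ultimately show ?thesis unfolding semiprimes_below_def by blast
qed

end

theory Submission
  imports
    Defs
    "Subresultants.Subresultant_Gcd"
    "Berlekamp_Zassenhaus.Factor_Bound"
    "HOL-Real_Asymp.Real_Asymp"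
begin

text \<open>For \<open>f = X^m - 1\<close> and \<open>g = (a - X)^m - 1\<close> let \<open>h\<close> be their greatest common divisor in \<open>\<int>[X]\<close>
  and let \<open>r\<close> be the resultant of the coprime cofactors \<open>f / h\<close> and \<open>g / h\<close>, a nonzero integer
  with \<open>r h \<in> (f, g)\<close>. If \<open>r\<close> is a unit modulo \<open>N\<close>, then \<open>h\<close> is a monic generator of \<open>(f, g)\<close>
  modulo \<open>N\<close>. If \<open>q\<close> does not divide \<open>r\<close>, then every common root \<open>z\<close> of \<open>f\<close> and \<open>g\<close> in
  characteristic \<open>q\<close> is a root of \<open>h\<close>; over \<open>\<complex>\<close> the roots of \<open>h\<close> satisfy
  \<open>z^k + (a - z)^k = a\<close> for all \<open>k\<close> coprime to \<open>m\<close>, so \<open>h\<close> divides \<open>X^k + (a - X)^k - a\<close>. Taking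
  \<open>z = x^p\<close> and \<open>k\<close> inverse to \<open>p\<close> modulo \<open>m\<close> turns \<open>x^p + y^p = a\<close> into \<open>x + y = a\<close>. So either
  property forces a prime divisor of \<open>N\<close> to divide \<open>r\<close>.

  By Mignotte's factor bound \<open>log r = O(m^2 log (|a| + 2))\<close>, hence all pairs \<open>(m, a)\<close> in the given
  range together involve only \<open>O(T^(3 c1 + c2) log T)\<close> primes, a vanishing proportion of the primes
  below \<open>T\<close> by Chebyshev's lower bound. The second claim follows from the case \<open>c1 = c2 = 1/5\<close>.\<close>

section \<open>Size of resultants\<close>

definition l1_norm :: "int poly \<Rightarrow> int" where
  "l1_norm p = (\<Sum>i\<le>degree p. \<bar>Polynomial.coeff p i\<bar>)"

lemma l1_norm_eq_sum:
  assumes "degree p \<le> n"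
  shows "l1_norm p = (\<Sum>i\<le>n. \<bar>Polynomial.coeff p i\<bar>)"
  unfolding l1_norm_def
  by (rule sum.mono_neutral_left) (use assms in \<open>auto simp: coeff_eq_0\<close>)

lemma l1_norm_nonneg: "0 \<le> l1_norm p"
  unfolding l1_norm_def by (simp add: sum_nonneg)

lemma l1_norm_diff_le: "l1_norm (p - q) \<le> l1_norm p + l1_norm q"
proof -
  define n where "n = max (degree p) (degree q)"
  have "degree (p - q) \<le> n" "degree p \<le> n" "degree q \<le> n"
    unfolding n_def by (auto intro: degree_diff_le)
  then have "l1_norm (p - q) = (\<Sum>i\<le>n. \<bar>Polynomial.coeff p i - Polynomial.coeff q i\<bar>)"
    and "l1_norm p + l1_norm q
      = (\<Sum>i\<le>n. \<bar>Polynomial.coeff p i\<bar> + \<bar>Polynomial.coeff q i\<bar>)"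
    by (simp_all add: l1_norm_eq_sum[of _ n] sum.distrib)
  then show ?thesis by (simp add: sum_mono abs_triangle_ineq4)
qed

lemma l1_norm_smult: "l1_norm (Polynomial.smult c p) = \<bar>c\<bar> * l1_norm p"
  using l1_norm_eq_sum[of "Polynomial.smult c p" "degree p"]
  by (simp add: degree_smult_le l1_norm_def abs_mult sum_distrib_left)

lemma l1_norm_pCons_0: "l1_norm (pCons 0 p) = l1_norm p"
  using l1_norm_eq_sum[of "pCons 0 p" "Suc (degree p)"]
  by (simp add: degree_pCons_le l1_norm_def sum.atMost_Suc_shift del: sum.atMost_Suc)

text \<open>Multiplying by \<open>a - X\<close> is scaling by \<open>a\<close> minus a shift of the
  coefficients, so each factor enlarges the norm by at most \<open>|a| + 1\<close>.\<close>

lemma l1_norm_linear_power: "l1_norm ([:a, -1:] ^ m) \<le> (\<bar>a\<bar> + 1) ^ m"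
proof (induction m)
  case (Suc m)
  have "[:a, -1:] ^ Suc m
    = Polynomial.smult a ([:a, -1:] ^ m) - pCons 0 ([:a, -1:] ^ m)"
    by (simp add: mult_pCons_left)
  then have "l1_norm ([:a, -1:] ^ Suc m)
      \<le> l1_norm (Polynomial.smult a ([:a, -1:] ^ m)) + l1_norm (pCons 0 ([:a, -1:] ^ m))"
    by (metis l1_norm_diff_le)
  also have "\<dots> = (\<bar>a\<bar> + 1) * l1_norm ([:a, -1:] ^ m)"
    by (simp add: l1_norm_smult l1_norm_pCons_0 algebra_simps)
  also have "\<dots> \<le> (\<bar>a\<bar> + 1) ^ Suc m"
    using Suc.IH by (simp add: mult_left_mono)
  finally show ?case .
qed (simp add: l1_norm_def)

lemma l1_norm_one [simp]: "l1_norm 1 = 1"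
  by (simp add: l1_norm_def)

lemma l1_norm_monom [simp]: "l1_norm (Polynomial.monom 1 m) = 1"
proof -
  have "l1_norm (Polynomial.monom 1 m) = (\<Sum>i\<le>m. if i = m then 1 else 0)"
    unfolding l1_norm_def by (simp add: Polynomial.degree_monom_eq if_distrib cong: if_cong)
  then show ?thesis by simp
qed

text \<open>Landau's inequality bounds the Mahler measure by the Euclidean norm of the coefficients,
  which is at most the l1 norm.\<close>

lemma mahler_measure_le_l1_norm: "mahler_measure p \<le> l1_norm p"
proof -
  have sq: "(\<Sum>a\<leftarrow>xs. a * a) \<le> (\<Sum>a\<leftarrow>xs. \<bar>a\<bar>)\<^sup>2" for xs :: "int list"
  proof (induction xs)
    case (Cons x xs)
    have "0 \<le> (\<Sum>a\<leftarrow>xs. \<bar>a\<bar>)" by (rule sum_list_nonneg) auto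
    then have "0 \<le> \<bar>x\<bar> * (\<Sum>a\<leftarrow>xs. \<bar>a\<bar>)" by simp
    with Cons show ?case
      by (simp add: power2_sum power2_eq_square algebra_simps)
  qed simp
  have "(\<Sum>a\<leftarrow>coeffs p. \<bar>a\<bar>) = l1_norm p"
  proof (cases "p = 0")
    case False
    have "(\<Sum>a\<leftarrow>coeffs p. \<bar>a\<bar>) = (\<Sum>i<length (coeffs p). \<bar>coeffs p ! i\<bar>)"
      by (simp add: sum_list_sum_nth atLeast0LessThan)
    also have "\<dots> = l1_norm p"
      using False unfolding l1_norm_def
      by (intro sum.cong) (auto simp: length_coeffs nth_coeffs_coeff)
    finally show ?thesis .
  qed (simp add: l1_norm_def)
  then have "(\<Sum>a\<leftarrow>coeffs p. a * a) \<le> (l1_norm p)\<^sup>2"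
    using sq[of "coeffs p"] by simp
  then have "sqrt (real_of_int (\<Sum>a\<leftarrow>coeffs p. a * a)) \<le> sqrt (real_of_int ((l1_norm p)\<^sup>2))"
    by (simp only: real_sqrt_le_iff of_int_le_iff)
  also have "\<dots> = l1_norm p"
    using l1_norm_nonneg by simp
  finally show ?thesis
    using Landau_inequality_mahler_measure[of p] by linarith
qed

text \<open>The Mahler measure does not grow on passing to a factor, and Mignotte bounds the
  coefficients of \<open>q\<close> by binomial coefficients times its Mahler measure; these binomial
  coefficients add up to \<open>2 ^ degree q\<close>.\<close>

lemma l1_norm_dvd_le:
  assumes "p \<noteq> 0" and "q dvd p"
  shows "l1_norm q \<le> 2 ^ degree q * l1_norm p"
proof -
  have "mahler_measure q \<le> mahler_measure p"
    using assms by (rule mahler_measure_dvd)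
  also have "\<dots> \<le> l1_norm p" by (rule mahler_measure_le_l1_norm)
  finally have mm: "mahler_measure q \<le> l1_norm p" .
  have "real_of_int (l1_norm q) = (\<Sum>i\<le>degree q. real_of_int \<bar>Polynomial.coeff q i\<bar>)"
    unfolding l1_norm_def by simp
  also have "\<dots> \<le> (\<Sum>i\<le>degree q. real (degree q choose i) * l1_norm p)"
    by (intro sum_mono order_trans[OF Mignotte_bound] mult_left_mono mm) simp
  also have "\<dots> = 2 ^ degree q * l1_norm p"
    by (simp flip: sum_distrib_right of_nat_sum add: choose_row_sum)
  finally have "real_of_int (l1_norm q) \<le> real_of_int (2 ^ degree q * l1_norm p)" by simp
  then show ?thesis by linarith
qed

text \<open>Extending the Leibniz sum of absolute values from permutations to all self-maps of the
  index set makes it factor into the product of the row sums.\<close>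

lemma abs_det_le_prod_row_sums:
  fixes A :: "int mat"
  assumes A: "A \<in> carrier_mat n n"
  shows "\<bar>det A\<bar> \<le> (\<Prod>i<n. \<Sum>j<n. \<bar>A $$ (i, j)\<bar>)"
proof -
  let ?P = "{p. p permutes {0..<n}}"
  have fin: "finite ?P" by (simp add: finite_permutations)
  have "\<bar>det A\<bar> \<le> (\<Sum>p\<in>?P. \<bar>signof p * (\<Prod>i = 0..<n. A $$ (i, p i))\<bar>)"
    unfolding det_def'[OF A] by (rule sum_abs)
  also have "\<dots> = (\<Sum>p\<in>?P. \<Prod>i<n. \<bar>A $$ (i, p i)\<bar>)"
    by (intro sum.cong) (auto simp: abs_mult abs_prod sign_def atLeast0LessThan)
  \<comment> \<open>Permutations are functions on all naturals; restriction, which is injective on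
    them, places them among the extensional functions of \<open>PiE\<close>.\<close>
  also have "\<dots> = (\<Sum>f\<in>(\<lambda>p. restrict p {..<n}) ` ?P. \<Prod>i<n. \<bar>A $$ (i, f i)\<bar>)"
  proof (subst sum.reindex)
    show "inj_on (\<lambda>p. restrict p {..<n}) ?P"
    proof (rule inj_onI, rule ext)
      fix p q i assume "p \<in> ?P" "q \<in> ?P" and eq: "restrict p {..<n} = restrict q {..<n}"
      moreover have "p i = q i" if "i < n"
        using fun_cong[OF eq, of i] that by (simp only: restrict_apply lessThan_iff if_True)
      ultimately show "p i = q i"
        by (cases "i < n") (simp_all add: permutes_not_in)
    qed
  qed (auto intro!: sum.cong)
  also have "\<dots> \<le> (\<Sum>f\<in>PiE {..<n} (\<lambda>_. {..<n}). \<Prod>i<n. \<bar>A $$ (i, f i)\<bar>)"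
  proof (rule sum_mono2)
    show "(\<lambda>p. restrict p {..<n}) ` ?P \<subseteq> PiE {..<n} (\<lambda>_. {..<n})"
      by (auto simp: permutes_in_image dest: permutes_in_image)
  qed (auto simp: finite_PiE intro: prod_nonneg)
  also have "\<dots> = (\<Prod>i<n. \<Sum>j<n. \<bar>A $$ (i, j)\<bar>)"
    by (rule prod_sum_PiE[symmetric]) auto
  finally show ?thesis .
qed

text \<open>The Sylvester matrix has \<open>degree q\<close> rows that are shifts of
  \<open>p\<close> and \<open>degree p\<close> rows that are shifts of \<open>q\<close>, so its
  absolute row sums are the two l1 norms.\<close>

lemma abs_resultant_le:
  fixes p q :: "int poly"
  shows "\<bar>resultant p q\<bar> \<le> l1_norm p ^ degree q * l1_norm q ^ degree p"
proof -
  define m n where "m = degree p" and "n = degree q"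
  let ?S = "sylvester_mat p q"
  have S: "?S \<in> carrier_mat (m + n) (m + n)"
    unfolding m_def n_def by (rule sylvester_carrier_mat)
  have row: "(\<Sum>j<m + n. \<bar>?S $$ (i, j)\<bar>) \<le> (if i < n then l1_norm p else l1_norm q)"
    if i: "i < m + n" for i
  proof (cases "i < n")
    case True
    have "(\<Sum>j<m + n. \<bar>?S $$ (i, j)\<bar>)
        = (\<Sum>j<m + n. if i \<le> j \<and> j - i \<le> m then \<bar>Polynomial.coeff p (m + i - j)\<bar> else 0)"
      using i True unfolding m_def n_def by (intro sum.cong) (auto simp: sylvester_index_mat)
    also have "\<dots> = (\<Sum>j\<in>{i..i+m}. \<bar>Polynomial.coeff p (m + i - j)\<bar>)"
      using True by (subst sum.inter_filter[symmetric]) (auto intro!: sum.cong)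
    also have "\<dots> = l1_norm p"
      unfolding l1_norm_def m_def[symmetric]
      by (rule sum.reindex_bij_witness[of _ "\<lambda>k. m + i - k" "\<lambda>j. m + i - j"]) auto
    finally show ?thesis using True by simp
  next
    case False
    have "(\<Sum>j<m + n. \<bar>?S $$ (i, j)\<bar>)
        = (\<Sum>j<m + n. if i - n \<le> j \<and> j \<le> i then \<bar>Polynomial.coeff q (i - j)\<bar> else 0)"
      using i False unfolding m_def n_def by (intro sum.cong) (auto simp: sylvester_index_mat)
    also have "\<dots> = (\<Sum>j\<in>{i-n..i}. \<bar>Polynomial.coeff q (i - j)\<bar>)"
      using i by (subst sum.inter_filter[symmetric]) (auto intro!: sum.cong)
    also have "\<dots> = l1_norm q"
      unfolding l1_norm_def n_def[symmetric] using False
      by (intro sum.reindex_bij_witness[of _ "\<lambda>k. i - k" "\<lambda>j. i - j"]) auto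
    finally show ?thesis using False by simp
  qed
  have "\<bar>resultant p q\<bar> \<le> (\<Prod>i<m + n. \<Sum>j<m + n. \<bar>?S $$ (i, j)\<bar>)"
    unfolding resultant_def by (rule abs_det_le_prod_row_sums[OF S])
  also have "\<dots> \<le> (\<Prod>i<m + n. if i < n then l1_norm p else l1_norm q)"
    by (intro prod_mono conjI row sum_nonneg) auto
  also have "\<dots> = (\<Prod>i\<in>{..<n}. l1_norm p) * (\<Prod>i\<in>{n..<m + n}. l1_norm q)"
  proof -
    have "{..<m + n} = {..<n} \<union> {n..<m + n}" by auto
    then show ?thesis by (simp add: prod.union_disjoint ivl_disj_int)
  qed
  also have "\<dots> = l1_norm p ^ n * l1_norm q ^ m" by simp
  finally show ?thesis unfolding m_def n_def .
qed

text \<open>The subresultant matrix of index 0 has the resultant as determinant, and each entry of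
  its last row is a multiple of \<open>p\<close> or \<open>q\<close>; expand along that row.
  Positive total degree ensures that the row exists.\<close>

lemma resultant_in_ideal:
  fixes p q :: "'a :: comm_ring_1 poly"
  assumes "degree p + degree q > 0"
  shows "\<exists>u v. u * p + v * q = [:resultant p q:]"
proof -
  define k where "k = degree p + degree q"
  let ?M = "subresultant_mat 0 p q"
  have M: "?M \<in> carrier_mat k k"
    unfolding k_def by (rule carrier_matI) auto
  have k: "k - 1 < k" using assms k_def by simp
  have ideal: "\<exists>u v. (\<Sum>j\<in>J. ?M $$ (k - 1, j) * cofactor ?M (k - 1) j) = u * p + v * q"
    if "finite J" "J \<subseteq> {..<k}" for J
    using that
  proof (induction J)
    case empty
    show ?case by (rule exI[of _ 0], rule exI[of _ 0]) simp
  next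
    case (insert j J)
    then obtain u v where uv: "(\<Sum>j\<in>J. ?M $$ (k - 1, j) * cofactor ?M (k - 1) j) = u * p + v * q"
      by auto
    have j: "j < k" using insert by auto
    obtain c where "?M $$ (k - 1, j) = c * p \<or> ?M $$ (k - 1, j) = c * q"
      using j k subresultant_index_mat[of "k - 1" p 0 q j]
      unfolding k_def by (auto simp: Let_def split: if_splits)
    then show ?case
    proof
      assume "?M $$ (k - 1, j) = c * p"
      then have "(\<Sum>j\<in>insert j J. ?M $$ (k - 1, j) * cofactor ?M (k - 1) j)
          = (c * cofactor ?M (k - 1) j + u) * p + v * q"
        using insert uv by (simp add: algebra_simps)
      then show ?thesis by blast
    next
      assume "?M $$ (k - 1, j) = c * q"
      then have "(\<Sum>j\<in>insert j J. ?M $$ (k - 1, j) * cofactor ?M (k - 1) j)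
          = u * p + (c * cofactor ?M (k - 1) j + v) * q"
        using insert uv by (simp add: algebra_simps)
      then show ?thesis by blast
    qed
  qed
  have "[:resultant p q:] = det ?M"
    using subresultant_resultant[of p q] by (simp add: subresultant_def)
  also have "\<dots> = (\<Sum>j<k. ?M $$ (k - 1, j) * cofactor ?M (k - 1) j)"
    by (rule laplace_expansion_row[OF M k, symmetric, THEN sym])
  finally show ?thesis using ideal[of "{..<k}"] by fastforce
qed

section \<open>Sums of two roots of unity\<close>

text \<open>Subtracting \<open>|z|^2 = 1\<close> from \<open>|a - z|^2 = 1\<close> leaves
  \<open>a (a - 2 Re z) = 0\<close>. Hence \<open>a - z\<close> is the conjugate of
  \<open>z\<close>, which is its inverse on the unit circle.\<close>

lemma root_of_unity_pair_real_sum: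
  fixes z :: complex and a :: int
  assumes "cmod z = 1" "cmod (of_int a - z) = 1" "a \<noteq> 0"
  shows "z * (of_int a - z) = 1"
proof -
  have 1: "(Re z)\<^sup>2 + (Im z)\<^sup>2 = 1"
    using assms(1) cmod_power2[of z] by simp
  have 2: "(of_int a - Re z)\<^sup>2 + (Im z)\<^sup>2 = 1"
    using assms(2) cmod_power2[of "of_int a - z"] by simp
  have "real_of_int a * (of_int a - 2 * Re z) = 0"
  proof -
    have "real_of_int a * (of_int a - 2 * Re z)
      = ((of_int a - Re z)\<^sup>2 + (Im z)\<^sup>2) - ((Re z)\<^sup>2 + (Im z)\<^sup>2)"
      by (simp add: power2_eq_square algebra_simps)
    then show ?thesis unfolding 1 2 by simp
  qed
  then have "of_int a = 2 * Re z" using assms(3) by simp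
  then have "of_int a - z = cnj z" by (simp add: complex_eq_iff)
  then show ?thesis using complex_norm_square[of z] assms(1) by simp
qed

lemma minus_one_power_eq_1_imp_even:
  assumes "(- 1 :: complex) ^ m = 1"
  shows "even m"
  using assms by (cases "even m") (simp_all add: uminus_power_if)

lemma cube_root_of_unity_power_eq_1_imp_dvd:
  fixes v :: complex
  assumes "v ^ 3 = 1" "v \<noteq> 1" "v ^ m = 1"
  shows "3 dvd m"
proof (rule ccontr)
  assume "\<not> 3 dvd m"
  then have "m mod 3 = 1 \<or> m mod 3 = 2" by presburger
  moreover have "v ^ (m mod 3) = 1"
    using assms by (metis div_mult_mod_eq power_add power_mult mult.commute power_one mult_1)
  moreover have "v ^ 3 = v * v ^ 2" by (simp add: power_numeral_reduce)
  ultimately show False using assms by auto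
qed

text \<open>Here \<open>z\<close> and \<open>w\<close> are the roots of
  \<open>X^2 - a X + 1\<close>, and \<open>a = 2, 1, -1, -2\<close> makes their order
  \<open>n = 1, 6, 3, 2\<close>. Being coprime to the multiple \<open>m\<close> of \<open>n\<close>,
  the exponent \<open>k\<close> is 1 or -1 modulo \<open>n\<close>.\<close>

lemma power_coprime_of_inverse_sum:
  fixes z w :: complex
  assumes zw: "z * w = 1" and sum: "z + w = of_int a" and a: "a \<noteq> 0" "\<bar>a\<bar> \<le> 2"
    and m: "z ^ m = 1" and k: "algebraic_semidom_class.coprime k m"
  shows "z ^ k + w ^ k = of_int a"
proof -
  have quad: "z * z = of_int a * z - 1"
    using zw arg_cong[OF sum, of "\<lambda>x. z * x"] by (simp add: algebra_simps)
  \<comment> \<open>Residue 1 fixes \<open>z\<close> and \<open>w\<close>, residue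
    \<open>n - 1\<close> exchanges them, as they are inverse to each other.\<close>
  have red: "z ^ k + w ^ k = of_int a" if n: "z ^ n = 1" "n > 0"
    and res: "k mod n = 1 \<or> k mod n = n - 1" for n
  proof -
    have wn: "w ^ n = 1" using zw n by (metis power_mult_distrib power_one mult_1)
    have zk: "z ^ k = z ^ (k mod n)" "w ^ k = w ^ (k mod n)"
      by (metis div_mult_mod_eq power_add power_mult mult.commute n(1) wn power_one mult_1)+
    from res show ?thesis
    proof
      assume "k mod n = 1" then show ?thesis using zk sum by simp
    next
      assume k': "k mod n = n - 1"
      have "z ^ (n - 1) * z = 1" "w ^ (n - 1) * w = 1"
        using n wn power_minus_mult[of n z] power_minus_mult[of n w] by simp_all
      then have "z ^ (n - 1) = w" "w ^ (n - 1) = z"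
        using zw by (metis mult.assoc mult.commute mult_1)+
      then show ?thesis using zk sum k' by (simp add: add.commute)
    qed
  qed
  have even: "odd k" if "even m" using k that by auto
  have three: "\<not> 3 dvd k" if "3 dvd m"
  proof
    assume "3 dvd k"
    with that have "is_unit (3 :: nat)" using coprime_common_divisor[OF k] by blast
    then show False by simp
  qed
  from a have "a \<in> {-2, -1, 1, 2}" by auto
  then consider "a = -2" | "a = -1" | "a = 1" | "a = 2" by auto
  then show ?thesis
  proof cases
    case 1
    then have "(z + 1) ^ 2 = z * z - (of_int a * z - 1)"
      by (simp add: power2_eq_square algebra_simps)
    then have "(z + 1) ^ 2 = 0" using quad by simp
    then have z: "z = - 1" by (simp add: eq_neg_iff_add_eq_0)
    then have "odd k" using m minus_one_power_eq_1_imp_even even by blast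
    then show ?thesis using red[of 2] z by (simp add: odd_iff_mod_2_eq_one)
  next
    case 2
    with quad have z2: "z * z = - z - 1" by simp
    then have z3: "z ^ 3 = 1" by (simp add: power3_eq_cube left_diff_distrib)
    moreover have "z \<noteq> 1" using z2 by auto
    ultimately have "\<not> 3 dvd k" using m three cube_root_of_unity_power_eq_1_imp_dvd by blast
    then have "k mod 3 = 1 \<or> k mod 3 = 3 - 1" by presburger
    then show ?thesis using red[OF z3] by simp
  next
    case 3
    with quad have z2: "z * z = z - 1" by simp
    then have z3: "z ^ 3 = - 1" by (simp add: power3_eq_cube left_diff_distrib)
    have "(- 1) ^ m = (z ^ m) ^ 3"
      unfolding z3[symmetric] by (simp flip: power_mult add: mult.commute)
    then have "(- 1 :: complex) ^ m = 1" using m by simp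
    then have "odd k" using minus_one_power_eq_1_imp_even even by blast
    \<comment> \<open>Thus \<open>z ^ 2\<close> is a nontrivial cube root of unity, which forces
      \<open>3 dvd m\<close> and so excludes \<open>3 dvd k\<close>.\<close>
    have "z ^ 2 \<noteq> 1"
    proof
      assume "z ^ 2 = 1"
      then have "z = 2" using z2 by (simp add: power2_eq_square)
      then show False using z2 by simp
    qed
    moreover have "(z ^ 2) ^ 3 = (z ^ 3) ^ 2" "(z ^ 2) ^ m = (z ^ m) ^ 2"
      by (simp_all flip: power_mult add: mult.commute)
    ultimately have "\<not> 3 dvd k"
      using z3 m three cube_root_of_unity_power_eq_1_imp_dvd[of "z ^ 2"] by simp
    with \<open>odd k\<close> have "k mod 6 = 1 \<or> k mod 6 = 6 - 1" by presburger
    moreover have "z ^ 6 = 1" using z3 power_mult[of z 3 2] by simp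
    ultimately show ?thesis using red by simp
  next
    case 4
    with quad have "(z - 1) ^ 2 = 0" by (simp add: power2_eq_square algebra_simps)
    \<comment> \<open>Every residue modulo 1 is \<open>0 = n - 1\<close>, the second alternative of
      \<open>red\<close>.\<close>
    then show ?thesis using red[of 1] by simp
  qed
qed

text \<open>For \<open>a = 0\<close> the two roots of unity are \<open>z\<close> and
  \<open>- z\<close>, which makes \<open>m\<close> even and \<open>k\<close> odd. Otherwise the
  triangle inequality gives \<open>|a| <= 2\<close>, the product of the two is 1, and the preceding
  case analysis applies.\<close>

lemma power_coprime_of_root_of_unity_sum:
  fixes z :: complex and a :: int
  assumes z: "z ^ m = 1" and w: "(of_int a - z) ^ m = 1" and "m > 0" and k: "algebraic_semidom_class.coprime k m"
  shows "z ^ k + (of_int a - z) ^ k = of_int a"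
proof (cases "a = 0")
  case True
  then have "(- z) ^ m = 1" using w by simp
  then have "(- 1) ^ m = (1 :: complex)" using z power_minus[of z m] by simp
  then have "even m" by (rule minus_one_power_eq_1_imp_even)
  then have "odd k" using k by auto
  then show ?thesis using True by simp
next
  case False
  have unit: "cmod x = 1" if "x ^ m = 1" for x
    using that \<open>m > 0\<close> by (metis norm_one norm_power norm_ge_zero power_eq_1_iff less_not_refl)
  have "cmod (z + (of_int a - z)) \<le> 2"
    using norm_triangle_ineq[of z "of_int a - z"] unit z w by simp
  then have "\<bar>a\<bar> \<le> 2" by simp
  moreover have "z * (of_int a - z) = 1"
    using root_of_unity_pair_real_sum unit z w False by blast
  ultimately show ?thesis
    using power_coprime_of_inverse_sum False z k by simp
qed

text \<open>Cancel \<open>gcd h p\<close>: were the cofactor of \<open>h\<close> nonconstant, one of its complex roots would be a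
  root of the cofactor of \<open>p\<close> as well, as the roots of \<open>h\<close> are simple; but the resultant of the
  two coprime cofactors is a nonzero integer in the ideal they generate.\<close>

lemma dvd_of_complex_roots:
  fixes h p :: "int poly"
  assumes monic: "lead_coeff h = 1"
    and simple: "\<And>z :: complex. poly (of_int_poly h) z = 0 \<Longrightarrow> poly (pderiv (of_int_poly h)) z \<noteq> 0"
    and root: "\<And>z :: complex. poly (of_int_poly h) z = 0 \<Longrightarrow> poly (of_int_poly p) z = 0"
  shows "h dvd p"
proof -
  let ?C = "of_int_poly :: int poly \<Rightarrow> complex poly"
  have "h \<noteq> 0" using monic by auto
  obtain u v d where h: "h = u * d" and p: "p = v * d" and "algebraic_semidom_class.coprime u v"
    using gcd_coprime_exists[of h p] \<open>h \<noteq> 0\<close> by auto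
  have "degree u = 0"
  proof (rule ccontr)
    assume deg: "degree u \<noteq> 0"
    then have "degree (?C u) \<noteq> 0" by simp
    then obtain z where z: "poly (?C u) z = 0"
      using fundamental_theorem_of_algebra[of "?C u"] by (auto simp: constant_degree)
    have "poly (?C h) z = 0" using z by (simp add: h hom_distribs)
    moreover from this have "poly (pderiv (?C h)) z \<noteq> 0" by (rule simple)
    then have "poly (?C d) z \<noteq> 0"
      using z by (auto simp: h hom_distribs pderiv_mult)
    ultimately have "poly (?C v) z = 0" using root by (force simp: p hom_distribs)
    obtain s t where st: "s * u + t * v = [:resultant u v:]"
      using resultant_in_ideal[of u v] deg by auto
    have "resultant u v \<noteq> 0"
      using \<open>algebraic_semidom_class.coprime u v\<close> by (simp add: resultant_0_gcd coprime_iff_gcd_eq_1)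
    moreover have "poly (?C (s * u + t * v)) z = 0"
      using z \<open>poly (?C v) z = 0\<close> by (simp add: hom_distribs)
    ultimately show False unfolding st by simp
  qed
  moreover have "lead_coeff u * lead_coeff d = 1" using monic by (simp add: h lead_coeff_mult)
  then have "is_unit (lead_coeff u)" by (metis dvd_triv_left)
  ultimately have "is_unit u" by (auto elim!: degree_eq_zeroE simp: is_unit_const_poly_iff)
  then show ?thesis unfolding h p by (auto intro: unit_imp_dvd)
qed

text \<open>\<open>h\<close> is the gcd over the integers, \<open>F\<close> and \<open>G\<close> are
  the cofactors, and \<open>R\<close> is their resultant, or 1 if both are constant. The bound
  combines the norms of the cofactors with degrees at most \<open>m\<close>.\<close>

lemma common_factor_resultant:
  fixes m :: nat and a :: int
  assumes m: "m > 0"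
  obtains h F G u v :: "int poly" and R :: int
  where "lead_coeff h = 1"
    and "Polynomial.monom 1 m - 1 = F * h" and "[:a, -1:] ^ m - 1 = G * h"
    and "u * F + v * G = [:R:]" and "R \<noteq> 0" and "\<bar>R\<bar> \<le> (16 * (\<bar>a\<bar> + 1)) ^ (m * m)"
    and "\<And>k. algebraic_semidom_class.coprime k m \<Longrightarrow> h dvd Polynomial.monom 1 k + [:a, -1:] ^ k - [:a:]"
proof -
  define f g :: "int poly" where "f = Polynomial.monom 1 m - 1" and "g = [:a, -1:] ^ m - 1"
  have deg_f: "degree f = m"
    unfolding f_def diff_conv_add_uminus
    using m by (subst degree_add_eq_left) (simp_all add: Polynomial.degree_monom_eq)
  have lead_f: "lead_coeff f = 1"
    unfolding deg_f unfolding f_def using m by simp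
  have deg_g: "degree g = m"
  proof -
    have "degree ([:a, -1:] ^ m) = m" by (simp add: degree_power_eq)
    then show ?thesis
      unfolding g_def diff_conv_add_uminus using m by (subst degree_add_eq_left) simp_all
  qed
  have "f \<noteq> 0" "g \<noteq> 0" using deg_f deg_g m by auto
  define h where "h = gcd f g"
  have "h \<noteq> 0" using \<open>f \<noteq> 0\<close> h_def by simp
  obtain F G where f: "f = F * h" and g: "g = G * h" and cop: "algebraic_semidom_class.coprime F G"
    using gcd_coprime_exists[of f g] \<open>h \<noteq> 0\<close> unfolding h_def by auto
  have "lead_coeff h = 1"
  proof -
    \<comment> \<open>A factor of a monic polynomial has leading coefficient 1 or -1; the
      normalization of the gcd rules out -1.\<close>
    have "lead_coeff F * lead_coeff h = 1" using lead_f by (simp add: f lead_coeff_mult)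
    then have "lead_coeff h = 1 \<or> lead_coeff h = -1"
      by (metis dvd_triv_right zdvd1_eq abs_eq_iff abs_1)
    moreover have "unit_factor h = 1" unfolding h_def using \<open>f \<noteq> 0\<close> by (simp add: unit_factor_gcd)
    then have "Polynomial.coeff (unit_factor h) 0 = 1" by simp
    then have "sgn (lead_coeff h) = 1" by (simp add: unit_factor_poly_def)
    ultimately show ?thesis by auto
  qed
  have deg: "degree F \<le> m" "degree G \<le> m"
    using deg_f deg_g \<open>f \<noteq> 0\<close> \<open>g \<noteq> 0\<close> unfolding f g by (auto simp: degree_mult_eq)
  have two: "(2 :: int) \<le> 2 ^ m" using m self_le_power[of "2 :: int" m] by simp
  have pow2: "(2 :: int) ^ degree F \<le> 2 ^ m" "(2 :: int) ^ degree G \<le> 2 ^ m"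
    using deg by (auto intro: power_increasing)
  have l1F: "l1_norm F \<le> 4 ^ m"
  proof -
    have "l1_norm F \<le> 2 ^ degree F * l1_norm f"
      by (rule l1_norm_dvd_le) (use \<open>f \<noteq> 0\<close> f in auto)
    also have "\<dots> \<le> 2 ^ m * 2 ^ m"
      using l1_norm_diff_le[of "Polynomial.monom 1 m" 1] two
      by (intro mult_mono pow2) (auto simp: f_def l1_norm_nonneg)
    finally show ?thesis by (simp flip: power_mult_distrib)
  qed
  have l1G: "l1_norm G \<le> (4 * (\<bar>a\<bar> + 1)) ^ m"
  proof -
    have one: "1 \<le> (\<bar>a\<bar> + 1) ^ m" by simp
    have "l1_norm G \<le> 2 ^ degree G * l1_norm g"
      by (rule l1_norm_dvd_le) (use \<open>g \<noteq> 0\<close> g in auto)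
    also have "l1_norm g \<le> (\<bar>a\<bar> + 1) ^ m + 1"
      unfolding g_def using l1_norm_diff_le[of "[:a, -1:] ^ m" 1] l1_norm_linear_power[of a m] by simp
    also have "\<dots> \<le> 2 * (\<bar>a\<bar> + 1) ^ m" using one by simp
    also have "\<dots> \<le> 2 ^ m * (\<bar>a\<bar> + 1) ^ m" using two by (intro mult_right_mono) auto
    also have "2 ^ degree G * (2 ^ m * (\<bar>a\<bar> + 1) ^ m) \<le> 2 ^ m * (2 ^ m * (\<bar>a\<bar> + 1) ^ m)"
      by (intro mult_right_mono pow2) simp
    finally show ?thesis by (simp flip: power_mult_distrib)
  qed
  have dvd: "h dvd Polynomial.monom 1 k + [:a, -1:] ^ k - [:a:]" if k: "algebraic_semidom_class.coprime k m" for k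
  proof (rule dvd_of_complex_roots)
    let ?C = "of_int_poly :: int poly \<Rightarrow> complex poly"
    fix z :: complex assume z: "poly (?C h) z = 0"
    have "poly (?C f) z = 0" "poly (?C g) z = 0" using z by (simp_all add: f g hom_distribs)
    then have zw: "z ^ m = 1" "(of_int a - z) ^ m = 1"
      by (simp_all add: f_def g_def hom_distribs poly_monom)
    show "poly (?C (Polynomial.monom 1 k + [:a, -1:] ^ k - [:a:])) z = 0"
      using power_coprime_of_root_of_unity_sum[OF zw m k]
      by (simp add: hom_distribs poly_monom)
    \<comment> \<open>A double root of \<open>h\<close> would be a double root of
      \<open>X^m - 1\<close>, whose derivative vanishes at no root of unity.\<close>
    show "poly (pderiv (?C h)) z \<noteq> 0"
    proof
      assume "poly (pderiv (?C h)) z = 0"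
      then have "poly (pderiv (?C f)) z = 0"
        using z by (simp add: f hom_distribs pderiv_mult)
      then have "of_nat m * z ^ (m - 1) = 0"
        by (simp add: f_def hom_distribs pderiv_diff pderiv_monom poly_monom)
      then show False using zw m by (auto simp: power_0_left split: if_splits)
    qed
  qed (rule \<open>lead_coeff h = 1\<close>)
  show ?thesis
  proof (cases "degree F + degree G = 0")
    \<comment> \<open>Constant cofactors are outside the scope of \<open>resultant_in_ideal\<close>;
      as \<open>f\<close> and \<open>h\<close> are monic, \<open>F = 1\<close> and
      \<open>R = 1\<close> serves.\<close>
    case True
    then obtain c where c: "F = [:c:]" by (meson add_is_0 degree_eq_zeroE)
    have "lead_coeff F * lead_coeff h = 1" using lead_f by (simp add: f lead_coeff_mult)
    then have "c = 1" using \<open>lead_coeff h = 1\<close> by (simp add: c)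
    then have "1 * F + 0 * G = [:1:]" using c by simp
    then show ?thesis
      using that[of h F G 1 0 1] \<open>lead_coeff h = 1\<close> f g dvd unfolding f_def g_def by auto
  next
    case False
    then obtain u v where uv: "u * F + v * G = [:resultant F G:]"
      using resultant_in_ideal[of F G] by auto
    have "resultant F G \<noteq> 0"
      using cop by (simp add: resultant_0_gcd coprime_iff_gcd_eq_1)
    moreover have "\<bar>resultant F G\<bar> \<le> (16 * (\<bar>a\<bar> + 1)) ^ (m * m)"
    proof -
      have "\<bar>resultant F G\<bar> \<le> l1_norm F ^ degree G * l1_norm G ^ degree F"
        by (rule abs_resultant_le)
      also have "\<dots> \<le> (4 ^ m) ^ degree G * ((4 * (\<bar>a\<bar> + 1)) ^ m) ^ degree F"
        by (intro mult_mono power_mono l1F l1G l1_norm_nonneg zero_le_power) auto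
      also have "\<dots> \<le> (4 ^ m) ^ m * ((4 * (\<bar>a\<bar> + 1)) ^ m) ^ m"
        by (intro mult_mono power_increasing deg one_le_power zero_le_power) auto
      also have "\<dots> = (16 * (\<bar>a\<bar> + 1)) ^ (m * m)"
        by (simp flip: power_mult power_mult_distrib)
      finally show ?thesis .
    qed
    ultimately show ?thesis
      using that[OF \<open>lead_coeff h = 1\<close>] f g uv dvd unfolding f_def g_def by blast
  qed
qed

section \<open>Reduction modulo \<open>N\<close> and evaluation in characteristic \<open>q\<close>\<close>

context residues
begin

text \<open>Product coefficients in \<open>UP\<close> are \<open>finsum\<close> convolutions in the
  residue ring; this compares them with integer convolutions.\<close>

lemma finsum_mod_eq:
  assumes "finite A"
  shows "(\<Oplus>i\<in>A. f i mod m) = (\<Sum>i\<in>A. f i) mod m"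
  using assms
proof induction
  case empty
  show ?case using m_gt_one by (simp add: res_zero_eq)
next
  case (insert i A)
  have "f j mod m \<in> carrier R" for j
    using m_gt_one by (simp add: res_carrier_eq)
  then show ?case
    using insert by (simp add: finsum_insert res_add_eq mod_simps)
qed

end

lemma reduce_poly_up:
  assumes "1 < N"
  shows "reduce_poly N P \<in> up (residue_ring (int N))"
proof (rule mem_upI)
  interpret residues "int N" "residue_ring (int N)"
    by unfold_locales (use assms in auto)
  show "reduce_poly N P n \<in> carrier (residue_ring (int N))" for n
    using assms by (simp add: reduce_poly_def res_carrier_eq)
  have "bound \<zero>\<^bsub>residue_ring (int N)\<^esub> (Polynomial.degree P) (reduce_poly N P)"
    by (auto simp: bound_def reduce_poly_def res_zero_eq coeff_eq_0)
  then show "\<exists>n. bound \<zero>\<^bsub>residue_ring (int N)\<^esub> n (reduce_poly N P)" ..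
qed

lemma reduce_poly_carrier:
  "1 < N \<Longrightarrow> reduce_poly N P \<in> carrier (UP (residue_ring (int N)))"
  using reduce_poly_up by (simp add: UP_def)

lemma reduce_poly_add:
  assumes "1 < N"
  shows "reduce_poly N P \<oplus>\<^bsub>UP (residue_ring (int N))\<^esub> reduce_poly N Q = reduce_poly N (P + Q)"
proof -
  interpret residues "int N" "residue_ring (int N)"
    by unfold_locales (use assms in auto)
  show ?thesis
    using assms reduce_poly_up
    by (simp add: UP_def) (simp add: reduce_poly_def res_add_eq mod_simps)
qed

lemma reduce_poly_mult:
  assumes "1 < N"
  shows "reduce_poly N P \<otimes>\<^bsub>UP (residue_ring (int N))\<^esub> reduce_poly N Q = reduce_poly N (P * Q)"
proof -
  interpret residues "int N" "residue_ring (int N)"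
    by unfold_locales (use assms in auto)
  show ?thesis
    using assms reduce_poly_up
    by (simp add: UP_def) (simp add: reduce_poly_def mult_cong finsum_mod_eq coeff_mult)
qed

text \<open>Since \<open>1 < N\<close>, the leading coefficient 1 stays nonzero modulo
  \<open>N\<close>, so reduction preserves the degree.\<close>

lemma monic_UP_reduce_poly:
  assumes "1 < N" and "lead_coeff P = 1"
  shows "monic_UP (residue_ring (int N)) (reduce_poly N P)"
proof -
  interpret residues "int N" "residue_ring (int N)"
    by unfold_locales (use assms in auto)
  interpret UP_ring "residue_ring (int N)" "UP (residue_ring (int N))"
    by unfold_locales
  have coeff: "up_ring.coeff (UP (residue_ring (int N))) (reduce_poly N P) = reduce_poly N P"
    using assms reduce_poly_up by (simp add: UP_def)
  have coeff_mod: "up_ring.coeff (UP (residue_ring (int N))) (reduce_poly N P) i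
      = Polynomial.coeff P i mod int N" for i
    unfolding coeff by (simp add: reduce_poly_def)
  have "UnivPoly.deg (residue_ring (int N)) (reduce_poly N P) = Polynomial.degree P"
    using assms
    by (intro le_antisym deg_aboveI deg_belowI reduce_poly_carrier)
       (auto simp: coeff_mod res_zero_eq coeff_eq_0)
  then show ?thesis
    using assms by (simp add: monic_UP_def reduce_poly_carrier coeff_mod res_one_eq)
qed

text \<open>Multiplying \<open>u F + v G = r\<close> by \<open>h\<close> and by an inverse
  \<open>w\<close> of \<open>r\<close> modulo \<open>N\<close> puts \<open>h\<close> into the ideal
  of the two polynomials, and both are multiples of \<open>h\<close>.\<close>

lemma not_sharp_property:
  fixes h F G u v :: "int poly"
  assumes monic: "lead_coeff h = 1"
    and f: "Polynomial.monom 1 m - 1 = F * h" and g: "[:a, -1:] ^ m - 1 = G * h"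
    and bezout: "u * F + v * G = [:r:]" and coprime: "algebraic_semidom_class.coprime r (int N)"
  shows "\<not> sharp_property N m a"
proof (cases "1 < N")
  case True
  let ?R = "residue_ring (int N)"
  let ?S = "UP ?R"
  interpret residues "int N" ?R
    by unfold_locales (use True in auto)
  interpret UP_cring ?R ?S
    by unfold_locales
  note carr = reduce_poly_carrier[OF True]
  let ?f = "reduce_poly N (Polynomial.monom 1 m - 1)"
  let ?g = "reduce_poly N ([:a, -1:] ^ m - 1)"
  let ?h = "reduce_poly N h"
  obtain w where "r * w mod int N = 1 mod int N"
    using coprime_iff_invertible_int[of r "int N"] coprime
    unfolding unique_euclidean_semiring_class.cong_def by blast
  then have w: "(w * r) mod int N = 1"
    using True by (simp add: mult.commute)
  have "?h = reduce_poly N (Polynomial.smult w u * (F * h) + Polynomial.smult w v * (G * h))"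
  proof -
    have "Polynomial.smult w u * (F * h) + Polynomial.smult w v * (G * h)
        = Polynomial.smult w (u * F + v * G) * h" by (simp add: algebra_simps smult_add_right)
    also have "\<dots> = Polynomial.smult (w * r) h" by (simp add: bezout)
    moreover have "reduce_poly N (Polynomial.smult (w * r) h) = ?h"
    proof (rule ext)
      fix i
      have "(w * r * Polynomial.coeff h i) mod int N
          = ((w * r) mod int N * Polynomial.coeff h i) mod int N"
        by (rule mod_mult_left_eq[symmetric])
      then show "reduce_poly N (Polynomial.smult (w * r) h) i = ?h i"
        unfolding w by (simp add: reduce_poly_def)
    qed
    ultimately show ?thesis by simp
  qed
  also have "\<dots> = reduce_poly N (Polynomial.smult w u) \<otimes>\<^bsub>?S\<^esub> ?f
      \<oplus>\<^bsub>?S\<^esub> reduce_poly N (Polynomial.smult w v) \<otimes>\<^bsub>?S\<^esub> ?g"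
    by (simp add: f g reduce_poly_add[OF True] reduce_poly_mult[OF True])
  finally have h: "?h = reduce_poly N (Polynomial.smult w u) \<otimes>\<^bsub>?S\<^esub> ?f
      \<oplus>\<^bsub>?S\<^esub> reduce_poly N (Polynomial.smult w v) \<otimes>\<^bsub>?S\<^esub> ?g" .
  interpret I: ideal "Idl\<^bsub>?S\<^esub> {?f, ?g}" ?S
    by (intro P.genideal_ideal) (use carr in auto)
  interpret J: ideal "Idl\<^bsub>?S\<^esub> {?h}" ?S
    by (intro P.genideal_ideal) (use carr in auto)
  have "?f \<in> Idl\<^bsub>?S\<^esub> {?f, ?g}" "?g \<in> Idl\<^bsub>?S\<^esub> {?f, ?g}" "?h \<in> Idl\<^bsub>?S\<^esub> {?h}"
    using P.genideal_self[of "{?f, ?g}"] P.genideal_self[of "{?h}"] carr by auto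
  moreover from this have "?h \<in> Idl\<^bsub>?S\<^esub> {?f, ?g}"
    using carr by (subst h) (intro I.a_closed I.I_l_closed; simp)
  moreover have "?f \<in> Idl\<^bsub>?S\<^esub> {?h}" "?g \<in> Idl\<^bsub>?S\<^esub> {?h}"
    unfolding f g reduce_poly_mult[OF True, symmetric]
    using carr \<open>?h \<in> Idl\<^bsub>?S\<^esub> {?h}\<close> by (auto intro: J.I_l_closed)
  ultimately have "Idl\<^bsub>?S\<^esub> {?h} = Idl\<^bsub>?S\<^esub> {?f, ?g}"
    by (intro equalityI P.genideal_minimal I.is_ideal J.is_ideal) auto
  then show ?thesis
    using monic_UP_reduce_poly[OF True monic] by (auto simp: sharp_property_def Let_def)
qed (simp add: sharp_property_def)

text \<open>Carries identities of \<open>int poly\<close> into a ring given by a carrier, such as an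
  algebraic closure of a prime field; the Horner form suits induction on
  \<open>pCons\<close>.\<close>

definition int_poly_eval :: "('a, 'b) ring_scheme \<Rightarrow> 'a \<Rightarrow> int poly \<Rightarrow> 'a" where
  "int_poly_eval L x p = fold_coeffs (\<lambda>c r. [c] \<cdot>\<^bsub>L\<^esub> \<one>\<^bsub>L\<^esub> \<oplus>\<^bsub>L\<^esub> x \<otimes>\<^bsub>L\<^esub> r) p \<zero>\<^bsub>L\<^esub>"

section \<open>Evaluation as a ring homomorphism\<close>

context cring
begin

lemma int_image_closed [simp]: "[(c :: int)] \<cdot> \<one> \<in> carrier R"
  by simp

lemma int_image_0 [simp]: "[(0 :: int)] \<cdot> \<one> = \<zero>"
  by (simp add: add_pow_int_ge)

lemma int_image_1 [simp]: "[(1 :: int)] \<cdot> \<one> = \<one>"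
  by (simp add: add_pow_int_ge)

lemma int_image_add: "[(c + d :: int)] \<cdot> \<one> = [c] \<cdot> \<one> \<oplus> [d] \<cdot> \<one>"
  by (simp add: add.int_pow_mult)

lemma int_image_mult: "[(c * d :: int)] \<cdot> \<one> = [c] \<cdot> \<one> \<otimes> [d] \<cdot> \<one>"
proof -
  have "[c] \<cdot> \<one> \<otimes> [d] \<cdot> \<one> = [c] \<cdot> (\<one> \<otimes> [d] \<cdot> \<one>)"
    by (rule add_pow_ldistr_int) auto
  then show ?thesis by (simp add: add.int_pow_pow mult.commute)
qed

lemma int_poly_eval_0 [simp]: "int_poly_eval R x 0 = \<zero>"
  by (simp add: int_poly_eval_def)

lemma int_poly_eval_pCons [simp]:
  assumes "x \<in> carrier R"
  shows "int_poly_eval R x (pCons c p) = [c] \<cdot> \<one> \<oplus> x \<otimes> int_poly_eval R x p"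
proof (cases "c = 0 \<and> p = 0")
  case False
  then show ?thesis
    by (cases "c = 0") (auto simp: int_poly_eval_def fold_coeffs_pCons_coeff_not_0_eq
        fold_coeffs_pCons_not_0_0_eq)
qed (use assms in simp)

lemma int_poly_eval_closed [simp]:
  "x \<in> carrier R \<Longrightarrow> int_poly_eval R x p \<in> carrier R"
  by (induction p) simp_all

lemma int_poly_eval_add:
  assumes x: "x \<in> carrier R"
  shows "int_poly_eval R x (p + q) = int_poly_eval R x p \<oplus> int_poly_eval R x q"
proof (induction p q rule: poly_induct2)
  case (pCons a p b q)
  then show ?case using x by (simp add: int_image_add r_distr a_ac)
qed simp

lemma int_poly_eval_smult:
  assumes x: "x \<in> carrier R"
  shows "int_poly_eval R x (Polynomial.smult c p) = [c] \<cdot> \<one> \<otimes> int_poly_eval R x p"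
proof (induction p)
  case (pCons a p)
  then show ?case using x by (simp add: int_image_mult r_distr m_ac)
qed simp

lemma int_poly_eval_mult:
  assumes x: "x \<in> carrier R"
  shows "int_poly_eval R x (p * q) = int_poly_eval R x p \<otimes> int_poly_eval R x q"
proof (induction p)
  case (pCons a p)
  then show ?case using x
    by (simp add: mult_pCons_left int_poly_eval_add int_poly_eval_smult l_distr m_assoc)
qed (use x in simp)

lemma int_poly_eval_const:
  "x \<in> carrier R \<Longrightarrow> int_poly_eval R x [:c:] = [c] \<cdot> \<one>"
  by simp

lemma int_poly_eval_1: "x \<in> carrier R \<Longrightarrow> int_poly_eval R x 1 = \<one>"
  by (simp only: one_pCons int_poly_eval_const int_image_1)

lemma int_poly_eval_power:
  assumes "x \<in> carrier R"
  shows "int_poly_eval R x (p ^ n) = int_poly_eval R x p [^] n"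
  by (induction n) (use assms in \<open>simp_all add: int_poly_eval_1 int_poly_eval_mult m_comm\<close>)

lemma int_poly_eval_monom:
  assumes "x \<in> carrier R"
  shows "int_poly_eval R x (Polynomial.monom 1 n) = x [^] n"
  by (induction n) (use assms in \<open>simp_all add: Polynomial.monom_0 Polynomial.monom_Suc int_poly_eval_1 m_comm\<close>)

lemma int_poly_eval_diff_eq_0_iff:
  assumes x: "x \<in> carrier R"
  shows "int_poly_eval R x (p - q) = \<zero> \<longleftrightarrow> int_poly_eval R x p = int_poly_eval R x q"
proof -
  have "int_poly_eval R x p = int_poly_eval R x (p - q) \<oplus> int_poly_eval R x q"
    using int_poly_eval_add[OF x, of "p - q" q] by simp
  then show ?thesis using x by (metis add.r_cancel_one' int_poly_eval_closed l_zero)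
qed

end

text \<open>The embedding \<open>indexed_const\<close> into the algebraic closure is a ring
  homomorphism, so it preserves multiples of one.\<close>

lemma (in field) char_alg_closure:
  assumes "[(n :: nat)] \<cdot> \<one> = \<zero>"
  shows "[n] \<cdot>\<^bsub>alg_closure\<^esub> \<one>\<^bsub>alg_closure\<^esub> = \<zero>\<^bsub>alg_closure\<^esub>"
proof -
  interpret L: algebraic_closure alg_closure "indexed_const ` carrier R"
    by (rule alg_closureE)
  interpret hom: ring_hom_ring R alg_closure indexed_const
    by (intro ring_hom_ringI2 alg_closureE L.ring_axioms ring_axioms)
  have "indexed_const ([k] \<cdot> \<one>) = [k] \<cdot>\<^bsub>alg_closure\<^esub> \<one>\<^bsub>alg_closure\<^esub>" for k :: nat
    by (induction k) (simp_all add: add.nat_pow_Suc L.add.nat_pow_Suc)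
  then show ?thesis using assms by (metis hom.hom_zero)
qed

text \<open>If \<open>q\<close> did not divide \<open>r\<close>, the common root \<open>x^p\<close>
  of the two polynomials would be a root of \<open>h\<close>, and the divisibility hypothesis for an
  inverse \<open>k\<close> of \<open>p\<close> modulo \<open>m\<close> would give
  \<open>x + y = a\<close>.\<close>

lemma natural_property_imp_prime_dvd:
  fixes h F G u v :: "int poly"
  assumes natural: "natural_property N m a"
    and f: "Polynomial.monom 1 m - 1 = F * h" and g: "[:a, -1:] ^ m - 1 = G * h"
    and bezout: "u * F + v * G = [:r:]"
    and dvd: "\<And>k. algebraic_semidom_class.coprime k m
      \<Longrightarrow> h dvd Polynomial.monom 1 k + [:a, -1:] ^ k - [:a:]"
  shows "\<exists>q. Factorial_Ring.prime q \<and> q dvd N \<and> int q dvd r"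
proof -
  obtain p q x y where p: "Factorial_Ring.prime p" "\<not> p dvd m"
    and q: "Factorial_Ring.prime q" "q dvd N"
    and L: "x \<in> carrier (field.alg_closure (residue_ring (int q)))"
      "y \<in> carrier (field.alg_closure (residue_ring (int q)))"
      "x [^]\<^bsub>field.alg_closure (residue_ring (int q))\<^esub> m = \<one>\<^bsub>field.alg_closure (residue_ring (int q))\<^esub>"
      "y [^]\<^bsub>field.alg_closure (residue_ring (int q))\<^esub> m = \<one>\<^bsub>field.alg_closure (residue_ring (int q))\<^esub>"
      "x [^]\<^bsub>field.alg_closure (residue_ring (int q))\<^esub> p
        \<oplus>\<^bsub>field.alg_closure (residue_ring (int q))\<^esub> y [^]\<^bsub>field.alg_closure (residue_ring (int q))\<^esub> p
        = [a] \<cdot>\<^bsub>field.alg_closure (residue_ring (int q))\<^esub> \<one>\<^bsub>field.alg_closure (residue_ring (int q))\<^esub>"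
      "x \<oplus>\<^bsub>field.alg_closure (residue_ring (int q))\<^esub> y
        \<noteq> [a] \<cdot>\<^bsub>field.alg_closure (residue_ring (int q))\<^esub> \<one>\<^bsub>field.alg_closure (residue_ring (int q))\<^esub>"
    using natural unfolding natural_property_def Let_def by blast
  define L where "L = field.alg_closure (residue_ring (int q))"
  note L = L[folded L_def]
  interpret K: residues_prime q "residue_ring (int q)"
    by (simp add: residues_prime_def q)
  interpret K: field "residue_ring (int q)" by (rule K.is_field)
  interpret algebraic_closure L "K.indexed_const ` carrier (residue_ring (int q))"
    unfolding L_def by (rule K.alg_closureE)
  have "int q dvd r"
  proof (rule ccontr)
    assume ndvd: "\<not> int q dvd r"
    \<comment> \<open>The characteristic is read off in the prime field, where \<open>k\<close>
      times one is \<open>k mod q\<close>, and transferred to \<open>L\<close>.\<close>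
    have q0: "[int q] \<cdot>\<^bsub>L\<^esub> \<one>\<^bsub>L\<^esub> = \<zero>\<^bsub>L\<^esub>"
    proof -
      have "[k] \<cdot>\<^bsub>residue_ring (int q)\<^esub> \<one>\<^bsub>residue_ring (int q)\<^esub> = int k mod int q" for k :: nat
        by (induction k) (simp_all add: K.add.nat_pow_Suc K.res_zero_eq K.res_one_eq K.res_add_eq mod_simps add.commute)
      then have "[q] \<cdot>\<^bsub>L\<^esub> \<one>\<^bsub>L\<^esub> = \<zero>\<^bsub>L\<^esub>"
        unfolding L_def by (intro K.char_alg_closure) (simp add: K.res_zero_eq)
      then show ?thesis by (simp add: add_pow_int_ge)
    qed
    have r: "[r] \<cdot>\<^bsub>L\<^esub> \<one>\<^bsub>L\<^esub> \<noteq> \<zero>\<^bsub>L\<^esub>"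
    proof
      assume "[r] \<cdot>\<^bsub>L\<^esub> \<one>\<^bsub>L\<^esub> = \<zero>\<^bsub>L\<^esub>"
      \<comment> \<open>In \<open>L\<close>, where \<open>q\<close> vanishes, this Bezout relation
        would become \<open>0 = 1\<close>.\<close>
      moreover obtain s t where "s * r + t * int q = 1"
        using bezout_int[of r "int q"] prime_imp_coprime[of "int q" r] q ndvd
        by (auto simp: algebraic_semidom_class.coprime_commute)
      ultimately show False
        using q0 int_image_add[of "s * r" "t * int q"] by (simp add: int_image_mult)
    qed
    define z w where "z = x [^]\<^bsub>L\<^esub> p" and "w = y [^]\<^bsub>L\<^esub> p"
    have carr: "z \<in> carrier L" "w \<in> carrier L" using L unfolding z_def w_def by auto
    have zm: "z [^]\<^bsub>L\<^esub> m = \<one>\<^bsub>L\<^esub>" "w [^]\<^bsub>L\<^esub> m = \<one>\<^bsub>L\<^esub>"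
      unfolding z_def w_def using L by (metis nat_pow_pow mult.commute nat_pow_one)+
    let ?ev = "int_poly_eval L z"
    \<comment> \<open>Because \<open>z + w = a\<close>, the polynomial \<open>a - X\<close> takes
      the value \<open>w\<close> at \<open>z\<close>, so \<open>z\<close> is a common root.\<close>
    have lin: "?ev [:a, -1:] = w"
    proof -
      have "?ev [:0, 1:] = z" using carr by (simp add: int_poly_eval_1)
      moreover have "?ev ([:a, -1:] + [:0, 1:]) = ?ev [:a, -1:] \<oplus>\<^bsub>L\<^esub> ?ev [:0, 1:]"
        by (rule int_poly_eval_add[OF carr(1)])
      moreover have "[:a, -1:] + [:0, 1:] = [:a:]"
        by (rule poly_eqI) (simp add: coeff_pCons split: nat.split)
      ultimately have "?ev [:a, -1:] \<oplus>\<^bsub>L\<^esub> z = w \<oplus>\<^bsub>L\<^esub> z"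
        using carr L by (simp only: int_poly_eval_const) (simp add: z_def w_def a_comm)
      then show ?thesis by (rule add.r_cancel[OF _ int_poly_eval_closed[OF carr(1)] carr(2) carr(1)])
    qed
    have "?ev (F * h) = \<zero>\<^bsub>L\<^esub>" "?ev (G * h) = \<zero>\<^bsub>L\<^esub>"
      unfolding f[symmetric] g[symmetric] using carr
      by (simp_all add: int_poly_eval_diff_eq_0_iff int_poly_eval_1 int_poly_eval_monom
          int_poly_eval_power lin zm del: int_poly_eval_pCons)
    then have "?ev (u * (F * h) + v * (G * h)) = \<zero>\<^bsub>L\<^esub>"
      using carr by (simp add: int_poly_eval_add int_poly_eval_mult[of z u] int_poly_eval_mult[of z v])
    also have "u * (F * h) + v * (G * h) = [:r:] * h"
      unfolding bezout[symmetric] by (simp add: algebra_simps)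
    finally have "[r] \<cdot>\<^bsub>L\<^esub> \<one>\<^bsub>L\<^esub> \<otimes>\<^bsub>L\<^esub> ?ev h = \<zero>\<^bsub>L\<^esub>"
      using carr by (simp add: int_poly_eval_smult)
    then have h0: "?ev h = \<zero>\<^bsub>L\<^esub>"
      using r carr integral_iff by auto
    have "algebraic_semidom_class.coprime p m" using p by (simp add: prime_imp_coprime)
    \<comment> \<open>\<open>k\<close> is an inverse of \<open>p\<close> modulo \<open>m\<close>,
      hence itself coprime to \<open>m\<close>.\<close>
    then obtain k j where kj: "p * k = m * j + 1"
      using bezout_nat[of p m] p by (auto simp: prime_nat_iff)
    have "algebraic_semidom_class.coprime k m"
    proof (rule algebraic_semidom_class.coprimeI)
      fix d assume "d dvd k" "d dvd m"
      then have "d dvd m * j + 1" "d dvd m * j" unfolding kj[symmetric] by auto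
      then show "is_unit d" using dvd_add_right_iff by blast
    qed
    then obtain c where c: "Polynomial.monom 1 k + [:a, -1:] ^ k - [:a:] = h * c"
      using dvd by (blast elim: dvdE)
    have "?ev (Polynomial.monom 1 k + [:a, -1:] ^ k - [:a:]) = \<zero>\<^bsub>L\<^esub>"
      unfolding c using carr h0 by (simp add: int_poly_eval_mult)
    then have "z [^]\<^bsub>L\<^esub> k \<oplus>\<^bsub>L\<^esub> w [^]\<^bsub>L\<^esub> k = [a] \<cdot>\<^bsub>L\<^esub> \<one>\<^bsub>L\<^esub>"
      using carr by (simp add: int_poly_eval_diff_eq_0_iff int_poly_eval_add int_poly_eval_monom
          int_poly_eval_power int_poly_eval_const lin del: int_poly_eval_pCons)
    \<comment> \<open>On \<open>m\<close>-th roots of unity the power \<open>k\<close> undoes the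
      power \<open>p\<close>, so \<open>x\<close> and \<open>y\<close> are recovered from
      \<open>z\<close> and \<open>w\<close>.\<close>
    moreover have "(t [^]\<^bsub>L\<^esub> p) [^]\<^bsub>L\<^esub> k = t" if "t \<in> carrier L" "t [^]\<^bsub>L\<^esub> m = \<one>\<^bsub>L\<^esub>" for t
    proof -
      have "(t [^]\<^bsub>L\<^esub> p) [^]\<^bsub>L\<^esub> k = t [^]\<^bsub>L\<^esub> (m * j + 1)"
        unfolding kj[symmetric] by (simp add: nat_pow_pow that)
      also have "\<dots> = (t [^]\<^bsub>L\<^esub> m) [^]\<^bsub>L\<^esub> j \<otimes>\<^bsub>L\<^esub> t"
        using that(1) by (simp add: nat_pow_pow)
      finally show ?thesis using that by simp
    qed
    ultimately show False using L unfolding z_def w_def by simp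
  qed
  then show ?thesis using q by blast
qed

section \<open>A lower bound of Chebyshev type\<close>

text \<open>Leibniz's harmonic triangle: \<open>1 / ((n + 1) (n choose k))\<close> is a difference of two entries
  of the preceding column.\<close>

lemma leibniz_triangle_dvd_Lcm:
  assumes "n < M" "k \<le> n"
  shows "Suc n * (n choose k) dvd Lcm {1..M}"
  using assms
proof (induction k arbitrary: n)
  case 0
  then show ?case by (intro dvd_Lcm) auto
next
  case (Suc k)
  obtain n' where n: "n = Suc n'" using Suc.prems by (cases n) auto
  let ?D = "Lcm {1..M} :: nat"
  have "Suc n' * (n' choose k) dvd ?D" "Suc n * (n choose k) dvd ?D"
    using Suc.IH[of n'] Suc.IH[of n] Suc.prems n by (simp_all del: mult_Suc)
  then obtain s t where s: "?D = Suc n' * (n' choose k) * s" and t: "?D = Suc n * (n choose k) * t"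
    unfolding dvd_def by blast
  have pos: "n' choose k > 0" "n choose k > 0" "n choose Suc k > 0"
    using Suc.prems n by auto
  have absorb: "Suc k * (n choose Suc k) = n * (n' choose k)"
    unfolding n by (rule Suc_times_binomial)
  have absorb': "(n - k) * (n choose k) = n * (n' choose k)"
    unfolding n using binomial_absorb_comp[of "Suc n'" k] by simp
  have "real ?D = real (Suc n * (n choose Suc k)) * (real s - real t)"
  proof -
    have s': "real s = real ?D / (real n * real (n' choose k))"
    proof -
      have "real ?D = real n * real (n' choose k) * real s" by (subst s) (simp add: n algebra_simps)
      then show ?thesis using pos n by simp
    qed
    have t': "real t = real ?D / (real (Suc n) * real (n choose k))"
    proof -
      have "real ?D = real (Suc n) * real (n choose k) * real t" by (subst t) (simp add: algebra_simps)
      then show ?thesis using pos by (simp del: of_nat_Suc)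
    qed
    have b: "real (n choose Suc k) = real n * real (n' choose k) / real (Suc k)"
      using arg_cong[OF absorb, of real] by (simp add: field_simps)
    have c: "real (n choose k) = real n * real (n' choose k) / real (n - k)"
      using arg_cong[OF absorb', of real] Suc.prems by (simp add: field_simps)
    have k: "real (n - k) = real n - real k" "real n - real k > 0" using Suc.prems by auto
    have "n > 0" using n by simp
    moreover have "D = (1 + N) * (A / (1 + K)) * (D / A - D / ((1 + N) * (A / (N - K))))"
      if "A > 0" "N > K" "K \<ge> 0" for A D K N :: real
      using that by (simp add: divide_simps) (simp add: algebra_simps)
    ultimately show ?thesis
      unfolding of_nat_mult s' t' b c k(1) using pos(1) k(2) by simp
  qed
  \<comment> \<open>Divisibility is read off over the integers, where \<open>s - t\<close> is a true
    difference.\<close>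
  then have "int ?D = int (Suc n * (n choose Suc k)) * (int s - int t)"
  proof -
    have "real_of_int (int (Suc n * (n choose Suc k)) * (int s - int t))
      = real (Suc n * (n choose Suc k)) * (real s - real t)"
      by (simp only: of_int_mult of_int_diff of_int_of_nat_eq)
    with \<open>real ?D = _\<close> show ?thesis by (metis of_int_eq_iff of_int_of_nat_eq)
  qed
  then have "int (Suc n * (n choose Suc k)) dvd int ?D" by (metis dvd_triv_left)
  then show ?case by (simp only: of_nat_dvd_iff)
qed

text \<open>Every prime power exactly dividing the least common multiple is at most
  \<open>M\<close>, and only primes up to \<open>M\<close> occur; so there is at most one factor of
  size at most \<open>M\<close> for each such prime.\<close>

lemma Lcm_le_power_card_primes:
  "Lcm {1..M :: nat} \<le> M ^ card {p. Factorial_Ring.prime p \<and> p \<le> M}"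
proof -
  let ?D = "Lcm {1..M} :: nat"
  let ?P = "{p. Factorial_Ring.prime p \<and> p \<le> M}"
  have D: "?D \<noteq> 0" by (auto simp: Lcm_0_iff)
  have P: "prime_factors ?D \<subseteq> ?P"
  proof
    fix p assume "p \<in> prime_factors ?D"
    then have p: "Factorial_Ring.prime p" "p dvd ?D" by (auto simp: prime_factors_dvd)
    have "?D dvd fact M" by (intro Lcm_least) (auto intro: dvd_fact)
    with p show "p \<in> ?P" using prime_dvd_fact_iff[OF p(1)] dvd_trans by blast
  qed
  have pow: "p ^ multiplicity p ?D \<le> M" if p: "p \<in> ?P" for p
  proof (rule ccontr)
    assume less: "\<not> p ^ multiplicity p ?D \<le> M"
    have "p > 0" using p by (auto simp: prime_gt_0_nat)
    define e where "e = multiplicity p ?D - 1"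
    have "multiplicity p ?D \<noteq> 0" using less p prime_ge_1_nat[of p] by (intro notI) auto
    then have e: "multiplicity p ?D = Suc e" by (simp add: e_def)
    obtain c where c: "?D = p ^ Suc e * c"
      using multiplicity_dvd[of p ?D] e by (auto elim: dvdE)
    \<comment> \<open>As \<open>p ^ Suc e\<close> exceeds \<open>M\<close>, it divides no
      \<open>i\<close> in the range, so removing one factor \<open>p\<close> from the least common
      multiple still leaves a common multiple.\<close>
    have "?D dvd p ^ e * c"
    proof (rule Lcm_least)
      fix i assume i: "i \<in> {1..M}"
      have "\<not> p ^ Suc e dvd i"
        using i less e by (auto dest: dvd_imp_le)
      moreover have "i dvd p ^ Suc e * c" using i c dvd_Lcm[of i "{1..M}"] by metis
      moreover obtain r where r: "i = p ^ multiplicity p i * r" "\<not> p dvd r"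
        using multiplicity_decompose'[of i p] i p by (auto simp: prime_nat_iff)
      ultimately have "multiplicity p i \<le> e" and "r dvd p ^ Suc e * c"
        using multiplicity_dvd'[of "Suc e" p i] by (metis not_less_eq_eq, metis dvd_mult_right)
      moreover have "algebraic_semidom_class.coprime r (p ^ Suc e)"
        using r p prime_imp_coprime[of p r] by (simp add: algebraic_semidom_class.coprime_commute)
      ultimately have "p ^ multiplicity p i dvd p ^ e" "r dvd c"
        by (simp_all add: le_imp_power_dvd coprime_dvd_mult_right_iff)
      then show "i dvd p ^ e * c" by (subst r) (rule mult_dvd_mono)
    qed
    have "c > 0" using D by (metis c gr0I mult_0_right)
    have "p > 1" using p prime_gt_1_nat by blast
    have "p ^ Suc e * c \<le> p ^ e * c"
      using \<open>?D dvd p ^ e * c\<close> \<open>c > 0\<close> \<open>p > 1\<close> unfolding c by (intro dvd_imp_le) auto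
    then show False using \<open>c > 0\<close> \<open>p > 1\<close> by simp
  qed
  have "?D = (\<Prod>p\<in>prime_factors ?D. p ^ multiplicity p ?D)"
    using D by (simp add: prod_prime_factors)
  also have "\<dots> \<le> (\<Prod>p\<in>prime_factors ?D. M)"
    using P pow by (intro prod_mono) auto
  also have "\<dots> = M ^ card (prime_factors ?D)" by simp
  also have "\<dots> \<le> M ^ card ?P"
  proof (cases "M = 0")
    case False
    then show ?thesis using P by (intro power_increasing card_mono) auto
  next
    \<comment> \<open>For \<open>M = 0\<close> powers are not monotone in the exponent, but both
      exponents are 0.\<close>
    case True
    then have "?P = {}" by auto
    then have "prime_factors ?D = {}" using P by blast
    with \<open>?P = {}\<close> show ?thesis by (simp only: card.empty power_0)
  qed
  finally show ?thesis .
qed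

text \<open>Take logarithms in \<open>4^n <= (2n + 1) C(2n, n) <= Lcm {1..2n+1}\<close>, where the
  last number is at most \<open>2n + 1\<close> raised to the number of primes up to
  \<open>2n + 1\<close>.\<close>

lemma card_primes_lower_bound:
  fixes n :: nat
  assumes "n > 0"
  shows "real n * ln 4 / ln (2 * n + 1) \<le> real (card {p. Factorial_Ring.prime p \<and> p \<le> 2 * n + 1})"
proof -
  let ?M = "2 * n + 1"
  let ?P = "{p. Factorial_Ring.prime p \<and> p \<le> ?M}"
  have "4 ^ n \<le> 2 * n * (2 * n choose n)"
  proof -
    have "real (4 ^ n) \<le> real (2 * n * (2 * n choose n))"
      using central_binomial_lower_bound[OF assms] assms by (simp add: pos_divide_le_eq mult_ac)
    then show ?thesis by (simp only: of_nat_le_iff)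
  qed
  also have "\<dots> \<le> Suc (2 * n) * (2 * n choose n)" by simp
  also have "\<dots> \<le> Lcm {1..?M}"
  proof (rule dvd_imp_le)
    show "Suc (2 * n) * (2 * n choose n) dvd Lcm {1..?M}"
      by (rule leibniz_triangle_dvd_Lcm) auto
    have "Lcm {1..?M} \<noteq> 0" by (auto simp: Lcm_0_iff)
    then show "Lcm {1..?M} > 0" by linarith
  qed
  also have "\<dots> \<le> ?M ^ card ?P" by (rule Lcm_le_power_card_primes)
  finally have "real (4 ^ n) \<le> real (?M ^ card ?P)" by (simp only: of_nat_le_iff)
  then have "ln (4 ^ n) \<le> ln (real ?M ^ card ?P)" by (simp del: of_nat_add of_nat_mult)
  then have "real n * ln 4 \<le> real (card ?P) * ln (real ?M)" by (simp add: ln_realpow del: of_nat_add)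
  moreover have "ln (real ?M) > 0" using assms by simp
  ultimately show ?thesis by (simp only: pos_divide_le_eq)
qed

section \<open>Counting exceptional semiprimes\<close>

text \<open>The integer \<open>r\<close> depends on \<open>m\<close> and \<open>a\<close> but not on
  \<open>N\<close>; the counting of exceptional primes rests on this uniformity.\<close>

lemma common_prime_of_property:
  fixes m :: nat and a :: int
  assumes "m > 0"
  shows "\<exists>r. r \<noteq> 0 \<and> \<bar>r\<bar> \<le> (16 * (\<bar>a\<bar> + 1)) ^ (m * m) \<and>
    (\<forall>N. sharp_property N m a \<or> natural_property N m a \<longrightarrow>
      (\<exists>q. Factorial_Ring.prime q \<and> q dvd N \<and> int q dvd r))"
proof -
  obtain h F G u v :: "int poly" and r :: int
    where h: "lead_coeff h = 1"
      and f: "Polynomial.monom 1 m - 1 = F * h" and g: "[:a, -1:] ^ m - 1 = G * h"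
      and bezout: "u * F + v * G = [:r:]" and r: "r \<noteq> 0" "\<bar>r\<bar> \<le> (16 * (\<bar>a\<bar> + 1)) ^ (m * m)"
      and dvd: "\<And>k. algebraic_semidom_class.coprime k m
        \<Longrightarrow> h dvd Polynomial.monom 1 k + [:a, -1:] ^ k - [:a:]"
    by (rule common_factor_resultant[OF assms, of a]) blast
  have "\<exists>q. Factorial_Ring.prime q \<and> q dvd N \<and> int q dvd r" if N: "sharp_property N m a" for N
  proof -
    have "\<not> algebraic_semidom_class.coprime r (int N)"
      using not_sharp_property[OF h f g bezout] N by blast
    then have "nat (gcd r (int N)) \<noteq> 1" by (auto simp: coprime_iff_gcd_eq_1 nat_eq_iff)
    then obtain q where q: "Factorial_Ring.prime q" "q dvd nat (gcd r (int N))"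
      using prime_factor_nat by blast
    then have "int q dvd gcd r (int N)" by (metis gcd_ge_0_int int_dvd_int_iff int_nat_eq)
    then show ?thesis using q by auto
  qed
  then show ?thesis
    using r natural_property_imp_prime_dvd[OF _ f g bezout dvd] by blast
qed

text \<open>\<open>n\<close> is a product of powers of its distinct primes, each power being at
  least 2.\<close>

lemma two_power_card_prime_factors_le:
  fixes n :: nat
  assumes "n > 0"
  shows "2 ^ card (prime_factors n) \<le> n"
proof -
  have "2 ^ card (prime_factors n) = (\<Prod>p\<in>prime_factors n. 2 :: nat)" by simp
  also have "\<dots> \<le> (\<Prod>p\<in>prime_factors n. p ^ multiplicity p n)"
  proof (rule prod_mono, safe)
    fix p assume p: "p \<in> prime_factors n"
    then have "2 \<le> p ^ 1" using prime_ge_2_nat[OF in_prime_factors_imp_prime[OF p]] by simp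
    also have "\<dots> \<le> p ^ multiplicity p n"
      using p by (intro power_increasing) (auto simp: prime_factors_multiplicity prime_gt_0_nat Suc_le_eq)
    finally show "2 \<le> p ^ multiplicity p n" .
  qed
  also have "\<dots> = n" using assms by (simp add: prod_prime_factors)
  finally show ?thesis .
qed

section \<open>Primes and semiprimes below \<open>T\<close>\<close>

abbreviation primes_below :: "nat \<Rightarrow> nat set" where
  "primes_below T \<equiv> {p. Factorial_Ring.prime p \<and> p < T}"

lemma finite_primes_below [simp]: "finite (primes_below T)"
  by (rule finite_subset[of _ "{..<T}"]) auto

text \<open>Two-element sets of primes map to semiprimes by taking products, injectively because a
  set is recovered as the prime factors of its product.\<close>

lemma card_semiprimes_below_ge: "card (primes_below T) choose 2 \<le> card (semiprimes_below T)"
proof -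
  let ?A = "{A. A \<subseteq> primes_below T \<and> card A = 2}"
  have factors: "prime_factors (\<Prod>A) = A" if "A \<in> ?A" for A
  proof -
    have "finite A" using that by (auto intro: finite_subset)
    then have "prime_factors (\<Prod>A) = (\<Union>p\<in>A. prime_factors p)"
      using that by (subst prime_factors_prod) auto
    also have "\<dots> = (\<Union>p\<in>A. {p})"
      using that by (intro SUP_cong) (auto simp: prime_factorization_prime)
    finally show ?thesis by simp
  qed
  have "card (primes_below T) choose 2 = card ?A"
    by (rule n_subsets[symmetric]) simp
  also have "\<dots> = card ((\<lambda>A. \<Prod>A) ` ?A)"
    by (rule card_image[symmetric]) (metis (no_types, lifting) factors inj_onI)
  also have "\<dots> \<le> card (semiprimes_below T)"
  proof (rule card_mono[OF finite_semiprimes_below], safe)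
    fix A assume A: "A \<subseteq> primes_below T" "card A = 2"
    then obtain p q where pq: "A = {p, q}" "p \<noteq> q" by (meson card_2_iff)
    then have prod: "\<Prod>A = p * q" by simp
    have p: "Factorial_Ring.prime p" "p < T" and q: "Factorial_Ring.prime q" "q < T"
      using A pq by auto
    then have "squarefree_semiprime (p * q)"
      unfolding squarefree_semiprime_def using pq(2) by blast
    moreover have "r < T" if r: "Factorial_Ring.prime r" "r dvd p * q" for r
    proof -
      have "r dvd p \<or> r dvd q" using r by (simp add: prime_dvd_mult_iff)
      then have "r = p \<or> r = q" using r(1) p(1) q(1) primes_dvd_imp_eq by blast
      then show ?thesis using p(2) q(2) by auto
    qed
    ultimately show "\<Prod>A \<in> semiprimes_below T"
      unfolding prod semiprimes_below_def by simp
  qed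
  finally show ?thesis .
qed

text \<open>A semiprime divisible by a prime of \<open>B\<close> is the product of that prime and
  another prime below \<open>T\<close>.\<close>

lemma card_semiprimes_dvd_le:
  assumes "B \<subseteq> primes_below T"
  shows "card {N \<in> semiprimes_below T. \<exists>q\<in>B. q dvd N} \<le> card B * card (primes_below T)"
proof -
  have "finite B" using assms finite_subset finite_primes_below by blast
  have "{N \<in> semiprimes_below T. \<exists>q\<in>B. q dvd N} \<subseteq> (\<lambda>(q, r). q * r) ` (B \<times> primes_below T)"
  proof safe
    fix N q assume N: "N \<in> semiprimes_below T" and q: "q \<in> B" "q dvd N"
    then obtain p r where pr: "Factorial_Ring.prime p" "Factorial_Ring.prime r" "N = p * r"
      by (auto simp: semiprimes_below_def squarefree_semiprime_def)
    have "p < T" "r < T" using N pr by (auto simp: semiprimes_below_def)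
    have "q = p \<or> q = r"
      using q pr assms by (metis (no_types, lifting) mem_Collect_eq prime_dvd_mult_iff primes_dvd_imp_eq subsetD)
    then show "N \<in> (\<lambda>(q, r). q * r) ` (B \<times> primes_below T)"
    proof
      assume "q = p"
      then show ?thesis using q pr \<open>r < T\<close> by auto
    next
      assume "q = r"
      then have "N = (\<lambda>(q, r). q * r) (q, p)" using pr by simp
      then show ?thesis using q pr \<open>p < T\<close> by blast
    qed
  qed
  then have "card {N \<in> semiprimes_below T. \<exists>q\<in>B. q dvd N}
      \<le> card ((\<lambda>(q, r). q * r) ` (B \<times> primes_below T))"
    using \<open>finite B\<close> by (intro card_mono) auto
  also have "\<dots> \<le> card (B \<times> primes_below T)"
    using \<open>finite B\<close> by (intro card_image_le) auto
  finally show ?thesis by (simp add: card_cartesian_product)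
qed

text \<open>\<open>B\<close> collects the primes below \<open>T\<close> dividing one of the integers
  attached to the pairs \<open>(m, a)\<close>. There are at most \<open>x (2 y + 1)\<close> pairs,
  and the binary logarithm of each integer's absolute value bounds its number of prime
  divisors.\<close>

lemma exceptional_primes_exist:
  fixes x y :: real
  assumes "x \<ge> 1" "y \<ge> 1"
  shows "\<exists>B. B \<subseteq> primes_below T \<and> real (card B) \<le> x * (2 * y + 1) * (x\<^sup>2 * log 2 (16 * (y + 1))) \<and>
    (\<forall>N m a. N \<in> semiprimes_below T \<longrightarrow> m > 0 \<longrightarrow> real m < x \<longrightarrow> real_of_int \<bar>a\<bar> < y \<longrightarrow>
      sharp_property N m a \<or> natural_property N m a \<longrightarrow> (\<exists>q\<in>B. q dvd N))"
proof -
  obtain r :: "nat \<Rightarrow> int \<Rightarrow> int" where r: "\<And>m a. m > 0 \<Longrightarrow> r m a \<noteq> 0"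
    "\<And>m a. m > 0 \<Longrightarrow> \<bar>r m a\<bar> \<le> (16 * (\<bar>a\<bar> + 1)) ^ (m * m)"
    "\<And>m a N. m > 0 \<Longrightarrow> sharp_property N m a \<or> natural_property N m a \<Longrightarrow>
       \<exists>q. Factorial_Ring.prime q \<and> q dvd N \<and> int q dvd r m a"
    using common_prime_of_property by metis
  define M where "M = {m. m > 0 \<and> real m < x}"
  define A where "A = {a :: int. real_of_int \<bar>a\<bar> < y}"
  define Q where "Q = (\<lambda>(m, a). prime_factors (nat \<bar>r m a\<bar>))"
  define B where "B = primes_below T \<inter> (\<Union>z\<in>M \<times> A. Q z)"
  have M: "M \<subseteq> {1..nat \<lfloor>x\<rfloor>}"
    unfolding M_def by (auto simp: le_nat_floor)
  then have "card M \<le> nat \<lfloor>x\<rfloor>" using card_mono[OF _ M] by simp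
  then have cM: "real (card M) \<le> x" using assms by linarith
  have A: "A \<subseteq> {-\<lfloor>y\<rfloor>..\<lfloor>y\<rfloor>}"
    unfolding A_def by (auto simp: abs_if le_floor_iff split: if_splits) linarith+
  then have "card A \<le> nat (2 * \<lfloor>y\<rfloor> + 1)" using card_mono[OF _ A] by simp
  then have cA: "real (card A) \<le> 2 * y + 1" using assms by linarith
  have fin: "finite M" "finite A" using M A finite_subset by auto
  have Q: "real (card (Q z)) \<le> x\<^sup>2 * log 2 (16 * (y + 1))" if "z \<in> M \<times> A" for z
  proof -
    obtain m a where "z = (m, a)" by (cases z)
    with that have z: "z = (m, a)" "m > 0" "real m < x" "real_of_int \<bar>a\<bar> < y"
      by (simp_all add: M_def A_def)
    let ?n = "nat \<bar>r m a\<bar>"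
    have "?n > 0" using r(1)[OF z(2)] by simp
    have "(2 :: real) ^ card (Q z) \<le> real ?n"
      unfolding z Q_def using two_power_card_prime_factors_le[OF \<open>?n > 0\<close>]
      by (simp flip: of_nat_le_iff[where 'a = real])
    also have "\<dots> \<le> real_of_int ((16 * (\<bar>a\<bar> + 1)) ^ (m * m))"
      using r(2)[OF z(2), of a] by linarith
    also have "\<dots> = (16 * (real_of_int \<bar>a\<bar> + 1)) ^ (m * m)" by simp
    also have "\<dots> \<le> (16 * (y + 1)) ^ (m * m)"
      using z by (intro power_mono) auto
    finally have "log 2 (2 ^ card (Q z)) \<le> log 2 ((16 * (y + 1)) ^ (m * m))"
      using assms by (subst log_le_cancel_iff) auto
    then have "real (card (Q z)) \<le> real (m * m) * log 2 (16 * (y + 1))"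
      using assms by (simp add: log_nat_power)
    also have "\<dots> \<le> x\<^sup>2 * log 2 (16 * (y + 1))"
      unfolding power2_eq_square of_nat_mult using z assms
      by (intro mult_right_mono mult_mono) auto
    finally show ?thesis .
  qed
  have "real (card B) \<le> real (card (\<Union>z\<in>M \<times> A. Q z))"
    unfolding B_def using fin by (intro of_nat_mono card_mono) (auto simp: Q_def)
  also have "\<dots> \<le> (\<Sum>z\<in>M \<times> A. real (card (Q z)))"
    using card_UN_le[of "M \<times> A" Q] fin by (simp flip: of_nat_sum)
  also have "\<dots> \<le> (\<Sum>z\<in>M \<times> A. x\<^sup>2 * log 2 (16 * (y + 1)))"
    by (rule sum_mono[OF Q])
  also have "\<dots> = real (card M) * real (card A) * (x\<^sup>2 * log 2 (16 * (y + 1)))"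
    by (simp add: card_cartesian_product)
  also have "\<dots> \<le> x * (2 * y + 1) * (x\<^sup>2 * log 2 (16 * (y + 1)))"
    using cM cA assms by (intro mult_right_mono mult_mono) auto
  finally have "real (card B) \<le> x * (2 * y + 1) * (x\<^sup>2 * log 2 (16 * (y + 1)))" .
  moreover have "\<exists>q\<in>B. q dvd N"
    if N: "N \<in> semiprimes_below T" and ma: "m > 0" "real m < x" "real_of_int \<bar>a\<bar> < y"
      and NP: "sharp_property N m a \<or> natural_property N m a" for N m a
  proof -
    obtain q where q: "Factorial_Ring.prime q" "q dvd N" "int q dvd r m a"
      using r(3)[OF ma(1) NP] by blast
    have "q < T" using N q by (auto simp: semiprimes_below_def)
    have "q dvd nat \<bar>r m a\<bar>" using q(3) by (simp add: nat_abs_dvd_iff dvd_nat_abs_iff)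
    then have "q \<in> Q (m, a)" unfolding Q_def using q r(1)[OF ma(1)] by (simp add: prime_factors_dvd)
    then have "q \<in> B" unfolding B_def M_def A_def using q \<open>q < T\<close> ma by auto
    then show ?thesis using q by blast
  qed
  ultimately show ?thesis by (intro exI[of _ B]) (auto simp: B_def)
qed

section \<open>Asymptotic estimates\<close>

lemma card_primes_below_ge:
  assumes "T \<ge> 4"
  shows "(real T - 3) / 2 * ln 4 / ln T \<le> real (card (primes_below T))"
proof -
  \<comment> \<open>This makes \<open>2 * n + 1\<close> the largest odd number below
    \<open>T\<close>.\<close>
  define n where "n = (T - 2) div 2"
  have n: "n > 0" "2 * n + 1 < T" "real n \<ge> (real T - 3) / 2"
    using assms unfolding n_def by (auto simp: real_of_nat_div) linarith?
  have "(real T - 3) / 2 * ln 4 / ln T \<le> real n * ln 4 / ln (2 * n + 1)"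
    using n assms by (intro frac_le mult_right_mono) auto
  also have "\<dots> \<le> real (card {p. Factorial_Ring.prime p \<and> p \<le> 2 * n + 1})"
    by (rule card_primes_lower_bound[OF n(1)])
  also have "\<dots> \<le> real (card (primes_below T))"
    using n(2) by (intro of_nat_mono card_mono) auto
  finally show ?thesis .
qed

text \<open>The numerator has order \<open>T^(1 - e) log T\<close> and the denominator order
  \<open>T / log T\<close>, so the quotient has order \<open>T^(-e) (log T)^2\<close>.\<close>

lemma density_bound_tendsto_0:
  fixes c e :: real
  assumes "e > 0" "c > 0"
  shows "((\<lambda>T. 6 * T powr (1 - e) * (5 + c * log 2 T) / ((T - 3) / 2 * ln 4 / ln T - 1)) \<longlongrightarrow> 0) at_top"
  using assms by real_asymp

lemma primes_bound_at_top:
  "filterlim (\<lambda>T. (T - 3) / 2 * ln 4 / ln T - 1 :: real) at_top at_top"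
  by real_asymp

text \<open>A semiprime \<open>N\<close> with prime divisors below \<open>T\<close> has
  \<open>ln N <= 2 ln T\<close>, so this places a fixed power of \<open>ln N\<close> below
  \<open>T^(1/5)\<close>.\<close>

lemma log_power_eventually_less:
  "eventually (\<lambda>T. (2 * ln T) powr c \<le> T powr (1 / 5 :: real)) at_top" if "c > 0"
  using that by real_asymp

text \<open>With \<open>P\<close> primes below \<open>T\<close>, at most \<open>card B * P\<close>
  semiprimes are exceptional out of at least \<open>P (P - 1) / 2\<close>, so the quotient is at
  most \<open>2 card B / (P - 1)\<close>. Admitting any subset \<open>S T\<close> covers each
  property alone and both together.\<close>

lemma exceptional_semiprimes_density:
  fixes c1 c2 :: real and S :: "nat \<Rightarrow> nat set"
  assumes c: "c1 > 0" "c2 > 0" "3 * c1 + c2 < 1"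
    and S: "\<And>T. S T \<subseteq> {N \<in> semiprimes_below T. \<exists>(m::nat) (a::int). m > 0 \<and>
      (sharp_property N m a \<or> natural_property N m a) \<and>
      real m < real T powr c1 \<and> real_of_int \<bar>a\<bar> < real T powr c2}"
  shows "(\<lambda>T. real (card (S T)) / real (card (semiprimes_below T))) \<longlonglongrightarrow> 0"
proof (rule tendsto_sandwich[OF _ _ tendsto_const])
  \<comment> \<open>The exponent is left unsimplified to match
    \<open>density_bound_tendsto_0\<close> with \<open>e = 1 - (3 c1 + c2)\<close>.\<close>
  let ?u = "\<lambda>T :: real. 6 * T powr (1 - (1 - (3 * c1 + c2))) * (5 + c2 * log 2 T)
    / ((T - 3) / 2 * ln 4 / ln T - 1)"
  show "(\<lambda>T. ?u (real T)) \<longlonglongrightarrow> 0"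
    using c by (intro filterlim_compose[OF density_bound_tendsto_0 filterlim_real_sequentially]) auto
  show "\<forall>\<^sub>F T in sequentially. 0 \<le> real (card (S T)) / real (card (semiprimes_below T))"
    by simp
  have "\<forall>\<^sub>F T in sequentially. 0 < (real T - 3) / 2 * ln 4 / ln (real T) - 1"
    using filterlim_compose[OF primes_bound_at_top filterlim_real_sequentially]
    unfolding filterlim_at_top_dense by blast
  then show "\<forall>\<^sub>F T in sequentially.
    real (card (S T)) / real (card (semiprimes_below T)) \<le> ?u (real T)"
    using eventually_ge_at_top[of 4]
  proof eventually_elim
    case (elim T)
    define x y where "x = real T powr c1" and "y = real T powr c2"
    have xy: "x \<ge> 1" "y \<ge> 1" using elim(2) c by (auto simp: x_def y_def ge_one_powr_ge_zero)
    define P where "P = real (card (primes_below T))"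
    obtain B where B: "B \<subseteq> primes_below T"
      "real (card B) \<le> x * (2 * y + 1) * (x\<^sup>2 * log 2 (16 * (y + 1)))"
      "\<And>N m a. N \<in> semiprimes_below T \<Longrightarrow> m > 0 \<Longrightarrow> real m < x \<Longrightarrow> real_of_int \<bar>a\<bar> < y \<Longrightarrow>
        sharp_property N m a \<or> natural_property N m a \<Longrightarrow> \<exists>q\<in>B. q dvd N"
      using exceptional_primes_exist[OF xy, of T] by meson
    have "S T \<subseteq> {N \<in> semiprimes_below T. \<exists>q\<in>B. q dvd N}"
      using S[of T] B(3) unfolding x_def y_def by blast
    then have "card (S T) \<le> card {N \<in> semiprimes_below T. \<exists>q\<in>B. q dvd N}"
      by (intro card_mono finite_subset[OF _ finite_semiprimes_below[of T]]) auto
    also have "\<dots> \<le> card B * card (primes_below T)"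
      by (rule card_semiprimes_dvd_le[OF B(1)])
    finally have num: "real (card (S T)) \<le> real (card B) * P"
      unfolding P_def of_nat_mult[symmetric] by (rule of_nat_mono)
    have PL: "(real T - 3) / 2 * ln 4 / ln (real T) - 1 \<le> P - 1"
      using card_primes_below_ge[OF elim(2)] by (simp add: P_def)
    then have P: "P > 1" using elim(1) by linarith
    have "P * (P - 1) / 2 = real (card (primes_below T) choose 2)"
    proof -
      define n where "n = card (primes_below T)"
      have "2 dvd n * (n - 1)" by (cases "even n") auto
      then have "real (n choose 2) = real (n * (n - 1)) / 2"
        unfolding choose_two by (subst real_of_nat_div) simp_all
      then show ?thesis using P unfolding P_def n_def by (simp add: of_nat_diff)
    qed
    also have "\<dots> \<le> real (card (semiprimes_below T))"
      by (intro of_nat_mono card_semiprimes_below_ge)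
    finally have den: "P * (P - 1) / 2 \<le> real (card (semiprimes_below T))" .
    have B': "real (card B) \<le> 3 * real T powr (3 * c1 + c2) * (5 + c2 * log 2 (real T))"
    proof -
      \<comment> \<open>As \<open>y >= 1\<close>, \<open>16 (y + 1) <= 32 y\<close>, whence the
        summand 5; likewise \<open>2 y + 1 <= 3 y\<close> gives the factor 3.\<close>
      have "log 2 (16 * (y + 1)) \<le> log 2 (2 ^ 5 * y)" using xy by simp
      also have "\<dots> = log 2 (2 ^ 5) + log 2 y" using xy by (subst log_mult) auto
      also have "log 2 (2 ^ 5 :: real) = 5" using log_pow_cancel[of "2 :: real" 5] by simp
      also have "log 2 y = c2 * log 2 (real T)" unfolding y_def using elim(2) by (simp add: log_powr)
      finally have l: "log 2 (16 * (y + 1)) \<le> 5 + c2 * log 2 (real T)" .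
      have "real (card B) \<le> x * (2 * y + 1) * (x\<^sup>2 * log 2 (16 * (y + 1)))" by (rule B(2))
      also have "\<dots> \<le> x * (3 * y) * (x\<^sup>2 * (5 + c2 * log 2 (real T)))"
        using xy l by (intro mult_mono mult_left_mono) auto
      also have "\<dots> = 3 * (x ^ 3 * y) * (5 + c2 * log 2 (real T))"
        by (simp add: power2_eq_square power3_eq_cube)
      also have "x ^ 3 * y = real T powr (3 * c1 + c2)"
        unfolding x_def y_def using elim(2) by (simp add: powr_add powr_powr mult.commute flip: powr_realpow)
      finally show ?thesis .
    qed
    have "real (card (S T)) / real (card (semiprimes_below T)) \<le> (real (card B) * P) / (P * (P - 1) / 2)"
      using num den P by (intro frac_le) auto
    also have "\<dots> = 2 * real (card B) / (P - 1)"
      using P by (simp add: field_simps)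
    also have "\<dots> \<le> ?u (real T)"
      using B' PL elim(1) by (intro frac_le) auto
    finally show ?case .
  qed
qed

text \<open>Since \<open>n - 1 <= n choose 2\<close>, there are at least
  \<open>card (primes_below T) - 1\<close> semiprimes, and the Chebyshev type bound applies.\<close>

lemma card_semiprimes_below_at_top:
  "filterlim (\<lambda>T. real (card (semiprimes_below T))) at_top sequentially"
proof (rule filterlim_at_top_mono)
  show "filterlim (\<lambda>T. ((real T - 3) / 2 * ln 4 / ln (real T) - 1)) at_top sequentially"
    by (rule filterlim_compose[OF primes_bound_at_top filterlim_real_sequentially])
  have "n - 1 \<le> n choose 2" for n
  proof (cases "n \<ge> 2")
    case True
    then have "2 * (n - 1) \<le> n * (n - 1)" by (intro mult_right_mono) auto
    then have "2 * (n - 1) div 2 \<le> n * (n - 1) div 2" by (rule div_le_mono)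
    then show ?thesis by (simp add: choose_two)
  qed auto
  then have "card (primes_below T) - 1 \<le> card (semiprimes_below T)" for T
    using card_semiprimes_below_ge[of T] order_trans by blast
  then have le: "real (card (primes_below T)) - 1 \<le> real (card (semiprimes_below T))" for T
    by (metis of_nat_diff_real of_nat_le_iff max.bounded_iff le_diff_conv of_nat_1 of_nat_add
        diff_le_eq)
  show "\<forall>\<^sub>F T in sequentially. (real T - 3) / 2 * ln 4 / ln (real T) - 1
      \<le> real (card (semiprimes_below T))"
    using eventually_ge_at_top[of 4]
  proof eventually_elim
    case (elim T)
    then show ?case using card_primes_below_ge[OF elim] le[of T] by linarith
  qed
qed

theorem corollary7p7:
  fixes c1 c2 :: real
  assumes "c1 > 0" and "c2 > 0"
  shows "(3 * c1 + c2 < 1 \<longrightarrow>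
            (\<lambda>T. real (card (sharp_set T c1 c2)) / real (card (semiprimes_below T)))
              \<longlonglongrightarrow> 0 \<and>
            (\<lambda>T. real (card (natural_set T c1 c2)) / real (card (semiprimes_below T)))
              \<longlonglongrightarrow> 0) \<and>
         \<not> (\<exists>C::real. C > 0 \<and>
              (\<exists>N0::nat. \<forall>N\<ge>N0. squarefree_semiprime N \<longrightarrow>
                (\<exists>(m::nat) (a::int). m > 0 \<and>
                  (sharp_property N m a \<or> natural_property N m a) \<and>
                  max (real m) (real_of_int \<bar>a\<bar>) < ln (real N) powr C)))"
proof (intro conjI impI notI)
  assume "3 * c1 + c2 < 1"
  note density = exceptional_semiprimes_density[OF assms this]
  show "(\<lambda>T. real (card (sharp_set T c1 c2)) / real (card (semiprimes_below T))) \<longlonglongrightarrow> 0"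
    by (rule density) (unfold sharp_set_def, blast)
  show "(\<lambda>T. real (card (natural_set T c1 c2)) / real (card (semiprimes_below T))) \<longlonglongrightarrow> 0"
    by (rule density) (unfold natural_set_def, blast)
next
  assume "\<exists>C::real. C > 0 \<and>
    (\<exists>N0::nat. \<forall>N\<ge>N0. squarefree_semiprime N \<longrightarrow>
      (\<exists>(m::nat) (a::int). m > 0 \<and>
        (sharp_property N m a \<or> natural_property N m a) \<and>
        max (real m) (real_of_int \<bar>a\<bar>) < ln (real N) powr C))"
  then obtain C :: real and N0 :: nat where C: "C > 0"
    and N0: "\<And>N. N \<ge> N0 \<Longrightarrow> squarefree_semiprime N \<Longrightarrow>
      \<exists>(m::nat) (a::int). m > 0 \<and> (sharp_property N m a \<or> natural_property N m a) \<and>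
        max (real m) (real_of_int \<bar>a\<bar>) < ln (real N) powr C"
    by blast
  \<comment> \<open>With \<open>c1 = c2 = 1/5\<close> one has \<open>3 c1 + c2 = 4/5 < 1\<close>;
    both properties are taken together, since the assumption may use either one for each
    \<open>N\<close>.\<close>
  define S where "S T = {N \<in> semiprimes_below T. \<exists>(m::nat) (a::int). m > 0 \<and>
      (sharp_property N m a \<or> natural_property N m a) \<and>
      real m < real T powr (1 / 5) \<and> real_of_int \<bar>a\<bar> < real T powr (1 / 5)}" for T
  let ?s = "\<lambda>T. real (card (semiprimes_below T))"
  have "(\<lambda>T. real (card (S T)) / ?s T) \<longlonglongrightarrow> 0"
    by (rule exceptional_semiprimes_density[of "1 / 5" "1 / 5"]) (auto simp: S_def)
  \<comment> \<open>The assumption is silent about numbers below \<open>N0\<close>, but these have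
    proportion tending to 0.\<close>
  moreover have "(\<lambda>T. real N0 / ?s T) \<longlonglongrightarrow> 0"
    by (intro tendsto_divide_0[OF tendsto_const] filterlim_at_top_imp_at_infinity
        card_semiprimes_below_at_top)
  ultimately have lim: "(\<lambda>T. real N0 / ?s T + real (card (S T)) / ?s T) \<longlonglongrightarrow> 0"
    using tendsto_add by fastforce
  have "\<forall>\<^sub>F T in sequentially. (2 * ln (real T)) powr C \<le> real T powr (1 / 5)"
    using log_power_eventually_less[OF C] filterlim_real_sequentially
    by (auto simp: filterlim_iff)
  then have "\<forall>\<^sub>F T in sequentially. 1 \<le> real N0 / ?s T + real (card (S T)) / ?s T"
    using eventually_ge_at_top[of 4]
  proof eventually_elim
    case (elim T)
    \<comment> \<open>By assumption each semiprime is below \<open>N0\<close> or exceptional, so two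
      proportions that tend to 0 would add up to at least 1.\<close>
    have "semiprimes_below T \<subseteq> {..<N0} \<union> S T"
    proof
      fix N assume N: "N \<in> semiprimes_below T"
      then obtain p q where pq: "Factorial_Ring.prime p" "Factorial_Ring.prime q" "N = p * q"
        and sq: "squarefree_semiprime N"
        by (auto simp: semiprimes_below_def squarefree_semiprime_def)
      then have "p < T" "q < T" "0 < N"
        using N by (auto simp: semiprimes_below_def prime_gt_0_nat)
      then have "real N \<le> real T ^ 2"
        unfolding pq(3) power2_eq_square of_nat_mult by (intro mult_mono) auto
      then have "ln (real N) \<le> ln (real T ^ 2)"
        using \<open>0 < N\<close> elim(2) by (subst ln_le_cancel_iff) auto
      then have "ln (real N) powr C \<le> (2 * ln (real T)) powr C"
        using \<open>0 < N\<close> elim(2) C by (intro powr_mono2) (auto simp: ln_realpow)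
      with elim(1) have bound: "ln (real N) powr C \<le> real T powr (1 / 5)" by linarith
      show "N \<in> {..<N0} \<union> S T"
      proof (cases "N < N0")
        case False
        then obtain m :: nat and a :: int where "m > 0"
          "sharp_property N m a \<or> natural_property N m a"
          "max (real m) (real_of_int \<bar>a\<bar>) < ln (real N) powr C"
          using N0[of N] sq by auto
        then have "N \<in> S T" unfolding S_def using N bound by fastforce
        then show ?thesis by simp
      qed simp
    qed
    then have "card (semiprimes_below T) \<le> card ({..<N0} \<union> S T)"
      by (intro card_mono) (auto simp: S_def finite_semiprimes_below)
    also have "\<dots> \<le> N0 + card (S T)" using card_Un_le[of "{..<N0}" "S T"] by simp
    finally have "?s T \<le> real N0 + real (card (S T))" by linarith
    moreover have "?s T > 0"
      using semiprimes_below_nonempty[OF elim(2)] finite_semiprimes_below[of T]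
      by (simp add: card_gt_0_iff)
    ultimately show ?case by (simp add: field_simps)
  qed
  then have "1 \<le> (0 :: real)"
    by (intro tendsto_lowerbound[OF lim]) auto
  then show False by simp
qed

end
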